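(* Let $k$ be an algebraically closed field and let $Q$ be a finite quiver together with a partition $V_1,V_2,\dots,V_n$ of the vertex set of $Q$, satisfying the properties: \begin{enumerate} \item there are no arrows from a vertex in $V_i$ to a vertex in $V_j$ if $i<j$; \item there are no arrows between distinct vertices in each $V_i$. \end{enumerate} Let $A=kQ/I$ with $I$ an admissible ideal, and let $B$ be a subalgebra of $A$ generated as a subalgebra by the elements (vertices and arrows) of a quiver $R$, whose vertices and arrows are elements of $A$, which satisfies the following properties: \begin{enumerate} \item[(i)] each vertex of $R$ is a sum of vertices of $Q$; \item[(ii)] the arrows $\beta$ of $R$ are linear combinations of paths in $Q$ and have the property that for any vertex $e$ of $Q$ there are vertices $h,g$ of $Q$ such that $\beta e=h\beta e$ and $e\beta=e\beta g$; \item[(iii)] for each vertex $e$ of $Q$ and each loop $\gamma$ of $Q$ at $e$, there is an element $\beta$ of $B$ such that $\gamma=e\beta$. \end{enumerate} Then the left relative global dimension $\mathrm{gldim}(A,B)$ is at most $n-1$.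
   Context: Algebras are associative and unital, subalgebras are unital, modules are left modules. Vertices of $Q$ are identified with the corresponding idempotents, paths are composed from right to left (an arrow $\alpha$ from $e$ to $f$ satisfies $\alpha=f\alpha e$), and vertices, arrows and paths of $Q$ are identified with their images in $A=kQ/I$. All equalities in (i)--(iii) are in $A$. An arrow $\beta$ of $R$ from the vertex $x$ to the vertex $y$ of $R$ satisfies $\beta=y\beta x$ in $A$. Relative notions. Let $B\subseteq A$ be an extension of algebras. An $A$-module is $(A,B)$-projective if it is isomorphic to a direct summand of $A\otimes_B V$ for some $B$-module $V$. An exact sequence of $A$-modules $\cdots\to M_{n+1}\to M_n\to M_{n-1}\to 0$ is $(A,B)$-exact if the kernel of each map $M_i\to M_{i-1}$, $i\geq n$, is a direct summand of $M_i$ as a $B$-module. The relative projective dimension $\mathrm{pd}_{(A,B)}M$ of an $A$-module $M$ is the least $n$ for which there is an $(A,B)$-exact sequence $0\to P_n\to\cdots\to P_0\to M\to 0$ with all $P_i$ $(A,B)$-projective (and $\infty$ if none exists). The left relative global dimension $\mathrm{gldim}(A,B)$ is the supremum of the relative projective dimensions of all left $A$-modules. *)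

theory Defs
  imports
    "Graph_Theory.Arc_Walk"
    "HOL-Algebra.Module"
    "HOL-Algebra.QuotRing"
    "HOL-Algebra.Ideal_Product"
    "HOL-Algebra.Embedded_Algebras"
    "HOL-Algebra.Free_Abelian_Groups"
    "HOL-Computational_Algebra.Polynomial"
    "HOL-Library.Disjoint_Sets"
    "HOL-Library.Extended_Nat"
begin

section \<open>Path algebras and their quotients\<close>

text \<open>
  A quiver is a (multi-)digraph. A path is a pair of its starting vertex and the list of its arrows
  in the order in which they are traversed, so \<open>(u, [])\<close> is the trivial path at \<open>u\<close> and the
  path written \<open>\<alpha>\<^sub>m \<dots> \<alpha>\<^sub>1\<close> (right to left) is \<open>(tail \<alpha>\<^sub>1, [\<alpha>\<^sub>1, \<dots>, \<alpha>\<^sub>m])\<close>.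
\<close>

definition paths :: "('v, 'e) pre_digraph \<Rightarrow> ('v \<times> 'e list) set" where
  "paths Q = {(u, p). \<exists>v. pre_digraph.awalk Q u p v}"

text \<open>
  Elements of \<open>kQ\<close> are the finitely supported functions on paths. In a product \<open>f g\<close> the
  factor \<open>g\<close> is traversed first: the coefficient at \<open>(u, p)\<close> runs over all ways to cut \<open>p\<close> into
  a first part, weighted by \<open>g\<close>, and a last part, weighted by \<open>f\<close>.
\<close>

definition path_algebra :: "('v, 'e) pre_digraph \<Rightarrow> ('v \<times> 'e list \<Rightarrow> 'k::field) ring" where
  "path_algebra Q =
     \<lparr>carrier = {f. finite {p. f p \<noteq> 0} \<and> {p. f p \<noteq> 0} \<subseteq> paths Q},
      monoid.mult = (\<lambda>f g (u, p). \<Sum>i\<le>length p.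
        f (last (pre_digraph.awalk_verts Q u (take i p)), drop i p) * g (u, take i p)),
      one = (\<lambda>(u, p). if u \<in> verts Q \<and> p = [] then 1 else 0),
      ring.zero = (\<lambda>_. 0),
      add = (\<lambda>f g p. f p + g p)\<rparr>"

definition single_path :: "'v \<times> 'e list \<Rightarrow> 'v \<times> 'e list \<Rightarrow> 'k::field" where
  "single_path p = (\<lambda>q. if q = p then 1 else 0)"

definition arrow_ideal :: "('v, 'e) pre_digraph \<Rightarrow> ('v \<times> 'e list \<Rightarrow> 'k::field) set" where
  "arrow_ideal Q = Idl\<^bsub>path_algebra Q\<^esub> ((\<lambda>a. single_path (tail Q a, [a])) ` arcs Q)"

definition admissible_ideal ::
  "('v, 'e) pre_digraph \<Rightarrow> ('v \<times> 'e list \<Rightarrow> 'k::field) set \<Rightarrow> bool" where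
  "admissible_ideal Q I \<longleftrightarrow>
     ideal I (path_algebra Q) \<and>
     I \<subseteq> arrow_ideal Q [^]\<^bsub>ideals_set (path_algebra Q)\<^esub> (2::nat) \<and>
     (\<exists>m::nat. 2 \<le> m \<and> arrow_ideal Q [^]\<^bsub>ideals_set (path_algebra Q)\<^esub> m \<subseteq> I)"

abbreviation quiver_algebra ::
  "('v, 'e) pre_digraph \<Rightarrow> ('v \<times> 'e list \<Rightarrow> 'k::field) set \<Rightarrow> ('v \<times> 'e list \<Rightarrow> 'k) set ring" where
  "quiver_algebra Q I \<equiv> path_algebra Q Quot I"

text \<open>Images in \<open>kQ/I\<close> of paths, vertices, arrows, and scalars (that is, multiples of the unit).\<close>

definition path_elem ::
  "('v, 'e) pre_digraph \<Rightarrow> ('v \<times> 'e list \<Rightarrow> 'k::field) set \<Rightarrow> 'v \<times> 'e list \<Rightarrow> ('v \<times> 'e list \<Rightarrow> 'k) set" where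
  "path_elem Q I p = I +>\<^bsub>path_algebra Q\<^esub> single_path p"

abbreviation vertex_elem ::
  "('v, 'e) pre_digraph \<Rightarrow> ('v \<times> 'e list \<Rightarrow> 'k::field) set \<Rightarrow> 'v \<Rightarrow> ('v \<times> 'e list \<Rightarrow> 'k) set" where
  "vertex_elem Q I e \<equiv> path_elem Q I (e, [])"

abbreviation arrow_elem ::
  "('v, 'e) pre_digraph \<Rightarrow> ('v \<times> 'e list \<Rightarrow> 'k::field) set \<Rightarrow> 'e \<Rightarrow> ('v \<times> 'e list \<Rightarrow> 'k) set" where
  "arrow_elem Q I a \<equiv> path_elem Q I (tail Q a, [a])"

definition scalar_elem ::
  "('v, 'e) pre_digraph \<Rightarrow> ('v \<times> 'e list \<Rightarrow> 'k::field) set \<Rightarrow> 'k \<Rightarrow> ('v \<times> 'e list \<Rightarrow> 'k) set" where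
  "scalar_elem Q I c = I +>\<^bsub>path_algebra Q\<^esub> (\<lambda>p. c * \<one>\<^bsub>path_algebra Q\<^esub> p)"

text \<open>
  The ring structure of an algebra determines its scalar multiplication once the image \<open>K\<close> of the
  ground field is known; the unital subalgebras are the subrings closed under multiplication by \<open>K\<close>.
\<close>

definition generated_subalgebra :: "'a set \<Rightarrow> ('a, 'b) ring_scheme \<Rightarrow> 'a set \<Rightarrow> 'a set" where
  "generated_subalgebra K A S = \<Inter>{C. subring C A \<and> subalgebra K C A \<and> S \<subseteq> C}"


section \<open>Left modules\<close>

text \<open>
  The locale \<open>module\<close> of the library requires a commutative ring. A module over a \<open>k\<close>-algebra is a
  module over the underlying ring, the vector space structure being induced by the unit. A subring
  \<open>B\<close> of \<open>A\<close> is regarded as the ring \<open>A\<lparr>carrier := B\<rparr>\<close>, so that restricting an \<open>A\<close>-module to \<open>B\<close>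
  does not change the module record.
\<close>

locale left_module = R?: ring R + M?: abelian_group M
  for R :: "('a, 'r) ring_scheme" (structure) and M :: "('a, 'm, 'c) module_scheme" (structure) +
  assumes smult_closed:
      "\<lbrakk>a \<in> carrier R; x \<in> carrier M\<rbrakk> \<Longrightarrow> a \<odot>\<^bsub>M\<^esub> x \<in> carrier M"
    and smult_l_distr:
      "\<lbrakk>a \<in> carrier R; b \<in> carrier R; x \<in> carrier M\<rbrakk> \<Longrightarrow>
       (a \<oplus>\<^bsub>R\<^esub> b) \<odot>\<^bsub>M\<^esub> x = a \<odot>\<^bsub>M\<^esub> x \<oplus>\<^bsub>M\<^esub> b \<odot>\<^bsub>M\<^esub> x"
    and smult_r_distr:
      "\<lbrakk>a \<in> carrier R; x \<in> carrier M; y \<in> carrier M\<rbrakk> \<Longrightarrow>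
       a \<odot>\<^bsub>M\<^esub> (x \<oplus>\<^bsub>M\<^esub> y) = a \<odot>\<^bsub>M\<^esub> x \<oplus>\<^bsub>M\<^esub> a \<odot>\<^bsub>M\<^esub> y"
    and smult_assoc:
      "\<lbrakk>a \<in> carrier R; b \<in> carrier R; x \<in> carrier M\<rbrakk> \<Longrightarrow>
       (a \<otimes>\<^bsub>R\<^esub> b) \<odot>\<^bsub>M\<^esub> x = a \<odot>\<^bsub>M\<^esub> (b \<odot>\<^bsub>M\<^esub> x)"
    and smult_one:
      "x \<in> carrier M \<Longrightarrow> \<one>\<^bsub>R\<^esub> \<odot>\<^bsub>M\<^esub> x = x"

definition left_module_hom ::
  "('a, 'r) ring_scheme \<Rightarrow> ('a, 'm, 'c) module_scheme \<Rightarrow> ('a, 'n, 'd) module_scheme \<Rightarrow> ('m \<Rightarrow> 'n) set" where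
  "left_module_hom R M N =
     {f \<in> carrier M \<rightarrow> carrier N.
        (\<forall>x\<in>carrier M. \<forall>y\<in>carrier M. f (x \<oplus>\<^bsub>M\<^esub> y) = f x \<oplus>\<^bsub>N\<^esub> f y) \<and>
        (\<forall>a\<in>carrier R. \<forall>x\<in>carrier M. f (a \<odot>\<^bsub>M\<^esub> x) = a \<odot>\<^bsub>N\<^esub> f x)}"

definition direct_summand ::
  "('a, 'r) ring_scheme \<Rightarrow> ('a, 'm, 'c) module_scheme \<Rightarrow> 'm set \<Rightarrow> bool" where
  "direct_summand R M H \<longleftrightarrow>
     submodule H R M \<and>
     (\<exists>H'. submodule H' R M \<and> H \<inter> H' = {\<zero>\<^bsub>M\<^esub>} \<and> H <+>\<^bsub>M\<^esub> H' = carrier M)"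

text \<open>
  \<open>A \<otimes>\<^sub>B V\<close> is the free abelian group on \<open>A \<times> V\<close> modulo the relations of a balanced product.
  The scalar \<open>a\<close> acts by \<open>a (a' \<otimes> v) = (a a') \<otimes> v\<close>; the action on a coset is the union of the
  cosets of the images of its representatives, which is a single coset. The fields
  \<open>mult\<close> and \<open>one\<close> of a module record play no role.
\<close>

definition tensor_relations ::
  "('a, 'r) ring_scheme \<Rightarrow> 'a set \<Rightarrow> ('a, 'v, 'c) module_scheme \<Rightarrow> ('a \<times> 'v \<Rightarrow>\<^sub>0 int) set" where
  "tensor_relations A B V =
     {frag_of (a \<oplus>\<^bsub>A\<^esub> a', v) - frag_of (a, v) - frag_of (a', v) | a a' v.
        a \<in> carrier A \<and> a' \<in> carrier A \<and> v \<in> carrier V} \<union>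
     {frag_of (a, v \<oplus>\<^bsub>V\<^esub> v') - frag_of (a, v) - frag_of (a, v') | a v v'.
        a \<in> carrier A \<and> v \<in> carrier V \<and> v' \<in> carrier V} \<union>
     {frag_of (a \<otimes>\<^bsub>A\<^esub> b, v) - frag_of (a, b \<odot>\<^bsub>V\<^esub> v) | a b v.
        a \<in> carrier A \<and> b \<in> B \<and> v \<in> carrier V}"

definition tensor_product ::
  "('a, 'r) ring_scheme \<Rightarrow> 'a set \<Rightarrow> ('a, 'v, 'c) module_scheme \<Rightarrow>
   ('a, ('a \<times> 'v \<Rightarrow>\<^sub>0 int) set) module" where
  "tensor_product A B V =
     (let F = free_Abelian_group (carrier A \<times> carrier V);
          N = generate F (tensor_relations A B V);
          T = F Mod N
      in \<lparr>carrier = carrier T,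
          monoid.mult = undefined,
          one = undefined,
          ring.zero = \<one>\<^bsub>T\<^esub>,
          add = (\<otimes>\<^bsub>T\<^esub>),
          module.smult = (\<lambda>a X. \<Union>f\<in>X.
            N #>\<^bsub>F\<^esub> frag_extend (\<lambda>(a', v). frag_of (a \<otimes>\<^bsub>A\<^esub> a', v)) f)\<rparr>)"


section \<open>Relative homological algebra\<close>

text \<open>
  All modules below have their carrier in one type \<open>'m\<close>, which serves as a universe. It is a free
  type variable, so a theorem about the notions below is about arbitrary modules. For a
  finite-dimensional algebra \<open>A\<close> over an infinite field the relative projective dimension of \<open>M\<close>
  does not depend on the universe containing \<open>M\<close>: a nonzero \<open>M\<close> is infinite and \<open>A \<otimes>\<^sub>B M\<close> has at
  most its cardinality, so the standard relative resolution of \<open>M\<close> exists in \<open>'m\<close>; and a relatively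
  projective \<open>P\<close> is a direct summand of \<open>A \<otimes>\<^sub>B P\<close>.
\<close>

definition rel_projective ::
  "('a, 'r) ring_scheme \<Rightarrow> 'a set \<Rightarrow> ('a, 'm) module \<Rightarrow> bool" where
  "rel_projective A B P \<longleftrightarrow>
     left_module A P \<and>
     (\<exists>V :: ('a, 'm) module. left_module (A\<lparr>carrier := B\<rparr>) V \<and>
        (\<exists>H f. direct_summand A (tensor_product A B V) H \<and>
           f \<in> left_module_hom A P (tensor_product A B V) \<and> bij_betw f (carrier P) H))"

text \<open>
  The sequence \<open>\<dots> \<rightarrow> X 2 \<rightarrow> X 1 \<rightarrow> X 0 \<rightarrow> 0\<close> with maps \<open>d i : X (i + 1) \<rightarrow> X i\<close> is exact, and it is
  split over \<open>B\<close> at the kernel of each \<open>d i\<close>.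
\<close>

definition rel_exact ::
  "('a, 'r) ring_scheme \<Rightarrow> 'a set \<Rightarrow> (nat \<Rightarrow> ('a, 'm) module) \<Rightarrow> (nat \<Rightarrow> 'm \<Rightarrow> 'm) \<Rightarrow> bool" where
  "rel_exact A B X d \<longleftrightarrow>
     (\<forall>i. left_module A (X i)) \<and>
     (\<forall>i. d i \<in> left_module_hom A (X (Suc i)) (X i)) \<and>
     d 0 ` carrier (X 1) = carrier (X 0) \<and>
     (\<forall>i. d (Suc i) ` carrier (X (Suc (Suc i))) = a_kernel (X (Suc i)) (X i) (d i)) \<and>
     (\<forall>i. direct_summand (A\<lparr>carrier := B\<rparr>) (X (Suc i)) (a_kernel (X (Suc i)) (X i) (d i)))"

text \<open>\<open>0 \<rightarrow> P\<^sub>n \<rightarrow> \<dots> \<rightarrow> P\<^sub>0 \<rightarrow> M \<rightarrow> 0\<close>, where \<open>P\<^sub>i = X (i + 1)\<close> and \<open>M = X 0\<close>.\<close>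

definition has_rel_resolution ::
  "('a, 'r) ring_scheme \<Rightarrow> 'a set \<Rightarrow> ('a, 'm) module \<Rightarrow> nat \<Rightarrow> bool" where
  "has_rel_resolution A B M n \<longleftrightarrow>
     (\<exists>X d. rel_exact A B X d \<and> X 0 = M \<and>
        (\<forall>i\<le>n. rel_projective A B (X (Suc i))) \<and>
        (\<forall>i>n. carrier (X (Suc i)) = {\<zero>\<^bsub>X (Suc i)\<^esub>}))"

definition rel_pd :: "('a, 'r) ring_scheme \<Rightarrow> 'a set \<Rightarrow> ('a, 'm) module \<Rightarrow> enat" where
  "rel_pd A B M = Inf {enat n | n. has_rel_resolution A B M n}"

definition rel_gldim :: "'m itself \<Rightarrow> ('a, 'r) ring_scheme \<Rightarrow> 'a set \<Rightarrow> enat" where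
  "rel_gldim _ A B = Sup {rel_pd A B M | M :: ('a, 'm) module. left_module A M}"

end

(*
  Let T = A \<otimes>\<^sub>B M. Condition (ii) makes the section \<sigma>(m) = \<Sum>\<^sub>e e \<otimes> e m of the multiplication map
  \<mu> : T \<rightarrow> M commute with B and with all vertices, and hence with the loops, which by (iii) are of the
  form e \<beta>. It extends to an A-linear projection \<pi>(a \<otimes> m) = a \<sigma>(m) of T onto a relatively projective
  module, namely A \<otimes>\<^sub>C M for the subalgebra C generated by B and the vertices, and \<mu> : im \<pi> \<rightarrow> M is
  split over B. If M is killed by all vertices of V\<^sub>i for i > j, then f a \<sigma>(m) = f \<sigma>(a m) for f in V\<^sub>i
  with i \<ge> j, since a path from a vertex not killing M to f is a product of loops; hence the kernel
  of \<mu> on im \<pi> is killed by all V\<^sub>i with i \<ge> j. For j = 1 the kernel vanishes and M itself is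
  relatively projective, so splicing these covers gives a resolution of length n - 1.

  To stay in the type of M, the module im \<pi> is transported along an injection: a nonzero M is
  infinite because the ground field is, and T has no more elements than M.
*)

theory Submission
  imports Defs
begin

section \<open>Left modules\<close>

text \<open>The map m \<mapsto> 1 \<otimes> m already splits \<mu> over B, but all of
  \<open>A \<otimes>\<^sub>B M\<close> is too large for the induction: B need not contain the
  vertices of Q, so a vertex e with e M = 0 may still leave elements e \<otimes> m \<noteq> 0 in the
  kernel of \<mu>. The projection \<pi> removes them, since it sends e \<otimes> m to e \<otimes> e
  m = 0. The larger ring C cannot simply take the place of B, because relative projectivity asks for
  summands of tensor products over B; this is why the cover is presented as the image of an
  idempotent endomorphism of T. Loops appear for the following reason. Arrows never raise the index
  of the block, and an arrow inside a block is a loop. A path that ends in a block of index at least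
  j and meets no block of index above j therefore stays at a single vertex. The bound j starts at n,
  where being killed by all later blocks is a vacuous condition, and drops by one with each cover; n
  - 1 covers reach j = 1.\<close>

context left_module
begin

lemma smult_zero [simp]:
  assumes "a \<in> carrier R" shows "a \<odot>\<^bsub>M\<^esub> \<zero>\<^bsub>M\<^esub> = \<zero>\<^bsub>M\<^esub>"
proof -
  have "a \<odot>\<^bsub>M\<^esub> \<zero>\<^bsub>M\<^esub> \<oplus>\<^bsub>M\<^esub> a \<odot>\<^bsub>M\<^esub> \<zero>\<^bsub>M\<^esub> = a \<odot>\<^bsub>M\<^esub> \<zero>\<^bsub>M\<^esub>"
    using smult_r_distr[of a "\<zero>\<^bsub>M\<^esub>" "\<zero>\<^bsub>M\<^esub>"] assms by simp
  then show ?thesis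
    using smult_closed[OF assms, of "\<zero>\<^bsub>M\<^esub>"] M.add.r_cancel_one by simp
qed

lemma zero_smult [simp]:
  assumes "x \<in> carrier M" shows "\<zero>\<^bsub>R\<^esub> \<odot>\<^bsub>M\<^esub> x = \<zero>\<^bsub>M\<^esub>"
proof -
  have "\<zero>\<^bsub>R\<^esub> \<odot>\<^bsub>M\<^esub> x \<oplus>\<^bsub>M\<^esub> \<zero>\<^bsub>R\<^esub> \<odot>\<^bsub>M\<^esub> x = \<zero>\<^bsub>R\<^esub> \<odot>\<^bsub>M\<^esub> x"
    using smult_l_distr[of "\<zero>\<^bsub>R\<^esub>" "\<zero>\<^bsub>R\<^esub>" x] assms by simp
  then show ?thesis
    using smult_closed[of "\<zero>\<^bsub>R\<^esub>" x] assms M.add.r_cancel_one by simp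
qed

lemma a_inv_smult:
  assumes "a \<in> carrier R" "x \<in> carrier M"
  shows "(\<ominus>\<^bsub>R\<^esub> a) \<odot>\<^bsub>M\<^esub> x = \<ominus>\<^bsub>M\<^esub> (a \<odot>\<^bsub>M\<^esub> x)"
proof -
  have "(\<ominus>\<^bsub>R\<^esub> a) \<odot>\<^bsub>M\<^esub> x \<oplus>\<^bsub>M\<^esub> a \<odot>\<^bsub>M\<^esub> x = \<zero>\<^bsub>M\<^esub>"
    using smult_l_distr[of "\<ominus>\<^bsub>R\<^esub> a" a x] assms by (simp add: R.l_neg)
  then show ?thesis
    using assms smult_closed by (simp add: M.minus_equality)
qed

lemma smult_finsum:
  assumes "a \<in> carrier R" "f \<in> S \<rightarrow> carrier M"
  shows "a \<odot>\<^bsub>M\<^esub> (\<Oplus>\<^bsub>M\<^esub>i\<in>S. f i) = (\<Oplus>\<^bsub>M\<^esub>i\<in>S. a \<odot>\<^bsub>M\<^esub> f i)"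
  using assms(2)
proof (induction S rule: infinite_finite_induct)
  case (insert i S)
  then have "f i \<in> carrier M" "f \<in> S \<rightarrow> carrier M" by auto
  moreover have "(\<lambda>i. a \<odot>\<^bsub>M\<^esub> f i) \<in> S \<rightarrow> carrier M"
    using calculation assms(1) smult_closed by auto
  ultimately show ?case
    using insert assms(1) by (simp add: smult_r_distr smult_closed)
qed (simp_all add: assms(1))

lemma finsum_smult:
  assumes "f \<in> S \<rightarrow> carrier R" "x \<in> carrier M"
  shows "(\<Oplus>\<^bsub>R\<^esub>i\<in>S. f i) \<odot>\<^bsub>M\<^esub> x = (\<Oplus>\<^bsub>M\<^esub>i\<in>S. f i \<odot>\<^bsub>M\<^esub> x)"
  using assms(1)
proof (induction S rule: infinite_finite_induct)
  case (insert i S)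
  then have "f i \<in> carrier R" "f \<in> S \<rightarrow> carrier R" by auto
  moreover have "(\<lambda>i. f i \<odot>\<^bsub>M\<^esub> x) \<in> S \<rightarrow> carrier M"
    using calculation assms(2) smult_closed by auto
  ultimately show ?case
    using insert assms(2) by (simp add: smult_l_distr smult_closed)
qed (simp_all add: assms(2))

lemma restrict_scalars:
  assumes "subring B R" shows "left_module (R\<lparr>carrier := B\<rparr>) M"
proof -
  have "B \<subseteq> carrier R" using assms subringE(1) by blast
  then show ?thesis
    using subring.axioms R.subring_is_ring[OF assms]
    by (intro left_module.intro left_module_axioms.intro M.abelian_group_axioms)
      (auto intro: smult_closed smult_l_distr smult_r_distr smult_assoc smult_one)
qed

lemma submodule_is_left_module:
  assumes "submodule H R M" shows "left_module R (M\<lparr>carrier := H\<rparr>)"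
proof -
  interpret H: submodule H R M by fact
  have sub: "H \<subseteq> carrier M" using H.subset by simp
  have "\<exists>y\<in>H. y \<oplus>\<^bsub>M\<^esub> x = \<zero>\<^bsub>M\<^esub>" if "x \<in> H" for x
  proof
    show "\<ominus>\<^bsub>M\<^esub> x \<oplus>\<^bsub>M\<^esub> x = \<zero>\<^bsub>M\<^esub>" using that sub M.l_neg by auto
    show "\<ominus>\<^bsub>M\<^esub> x \<in> H" using H.m_inv_closed[OF that] by (simp add: a_inv_def)
  qed
  then have "abelian_group (M\<lparr>carrier := H\<rparr>)"
    using sub H.m_closed H.one_closed by (intro abelian_groupI) (simp_all add: M.a_ac subset_iff)
  then show ?thesis
    using sub by (intro left_module.intro left_module_axioms.intro R.ring_axioms)
      (auto intro: smult_l_distr smult_r_distr smult_assoc smult_one)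
qed

text \<open>Closure under negatives comes for free, because -x = (-1) x.\<close>

lemma submoduleI:
  assumes "H \<subseteq> carrier M" "\<zero>\<^bsub>M\<^esub> \<in> H"
    and "\<And>x y. x \<in> H \<Longrightarrow> y \<in> H \<Longrightarrow> x \<oplus>\<^bsub>M\<^esub> y \<in> H"
    and smult: "\<And>a x. a \<in> carrier R \<Longrightarrow> x \<in> H \<Longrightarrow> a \<odot>\<^bsub>M\<^esub> x \<in> H"
  shows "submodule H R M"
proof (intro submodule.intro submodule_axioms.intro M.add.subgroupI)
  fix x assume x: "x \<in> H"
  then have "\<ominus>\<^bsub>M\<^esub> x = (\<ominus>\<^bsub>R\<^esub> \<one>\<^bsub>R\<^esub>) \<odot>\<^bsub>M\<^esub> x"
    using assms(1) by (auto simp: a_inv_smult smult_one)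
  then show "\<ominus>\<^bsub>M\<^esub> x \<in> H"
    using smult[of "\<ominus>\<^bsub>R\<^esub> \<one>\<^bsub>R\<^esub>"] x by simp
qed (use assms in auto)

end

section \<open>Homomorphisms, kernels, images and direct summands\<close>

lemma left_module_homI:
  assumes "\<And>x. x \<in> carrier M \<Longrightarrow> f x \<in> carrier N"
    and "\<And>x y. x \<in> carrier M \<Longrightarrow> y \<in> carrier M \<Longrightarrow> f (x \<oplus>\<^bsub>M\<^esub> y) = f x \<oplus>\<^bsub>N\<^esub> f y"
    and "\<And>a x. a \<in> carrier R \<Longrightarrow> x \<in> carrier M \<Longrightarrow> f (a \<odot>\<^bsub>M\<^esub> x) = a \<odot>\<^bsub>N\<^esub> f x"
  shows "f \<in> left_module_hom R M N"
  using assms by (auto simp: left_module_hom_def)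

lemma left_module_homD:
  assumes "f \<in> left_module_hom R M N"
  shows "x \<in> carrier M \<Longrightarrow> f x \<in> carrier N"
    and "x \<in> carrier M \<Longrightarrow> y \<in> carrier M \<Longrightarrow> f (x \<oplus>\<^bsub>M\<^esub> y) = f x \<oplus>\<^bsub>N\<^esub> f y"
    and "a \<in> carrier R \<Longrightarrow> x \<in> carrier M \<Longrightarrow> f (a \<odot>\<^bsub>M\<^esub> x) = a \<odot>\<^bsub>N\<^esub> f x"
  using assms by (auto simp: left_module_hom_def)

lemma left_module_hom_zero:
  assumes "f \<in> left_module_hom R M N" "left_module R M" "left_module R N"
  shows "f \<zero>\<^bsub>M\<^esub> = \<zero>\<^bsub>N\<^esub>"
proof -
  interpret M: left_module R M by fact
  interpret N: left_module R N by fact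
  have "f (\<zero>\<^bsub>R\<^esub> \<odot>\<^bsub>M\<^esub> \<zero>\<^bsub>M\<^esub>) = \<zero>\<^bsub>R\<^esub> \<odot>\<^bsub>N\<^esub> f \<zero>\<^bsub>M\<^esub>"
    using left_module_homD[OF assms(1)] by blast
  then show ?thesis
    using left_module_homD(1)[OF assms(1)] by simp
qed

lemma left_module_hom_a_inv:
  assumes "f \<in> left_module_hom R M N" "left_module R M" "left_module R N" "x \<in> carrier M"
  shows "f (\<ominus>\<^bsub>M\<^esub> x) = \<ominus>\<^bsub>N\<^esub> f x"
proof -
  interpret M: left_module R M by fact
  interpret N: left_module R N by fact
  have "f (\<ominus>\<^bsub>M\<^esub> x) \<oplus>\<^bsub>N\<^esub> f x = \<zero>\<^bsub>N\<^esub>"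
    using left_module_homD(2)[OF assms(1), of "\<ominus>\<^bsub>M\<^esub> x" x] assms(4) left_module_hom_zero[OF assms(1-3)]
    by (simp add: M.M.l_neg)
  then show ?thesis
    using left_module_homD(1)[OF assms(1)] assms(4) by (simp add: N.M.minus_equality)
qed

lemma left_module_hom_finsum:
  assumes "f \<in> left_module_hom R M N" "left_module R M" "left_module R N" "g \<in> S \<rightarrow> carrier M"
  shows "f (\<Oplus>\<^bsub>M\<^esub>i\<in>S. g i) = (\<Oplus>\<^bsub>N\<^esub>i\<in>S. f (g i))"
proof -
  interpret M: left_module R M by fact
  interpret N: left_module R N by fact
  note f = left_module_homD[OF assms(1)]
  show ?thesis
    using assms(4)
  proof (induction S rule: infinite_finite_induct)
    case (insert i S)
    then have "g i \<in> carrier M" "g \<in> S \<rightarrow> carrier M" by auto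
    moreover have "(\<lambda>i. f (g i)) \<in> S \<rightarrow> carrier N"
      using calculation f(1) by auto
    ultimately show ?case
      using insert by (simp add: f)
  qed (simp_all add: left_module_hom_zero[OF assms(1-3)])
qed

lemma left_module_hom_compose:
  assumes "f \<in> left_module_hom R M N" "g \<in> left_module_hom R N P"
  shows "(\<lambda>x. g (f x)) \<in> left_module_hom R M P"
  using assms by (auto simp: left_module_hom_def Pi_iff)

lemma left_module_hom_restrict_scalars:
  assumes "f \<in> left_module_hom R M N" "B \<subseteq> carrier R"
  shows "f \<in> left_module_hom (R\<lparr>carrier := B\<rparr>) M N"
  using assms by (auto simp: left_module_hom_def)

lemma mem_a_kernel_iff: "x \<in> a_kernel M N f \<longleftrightarrow> x \<in> carrier M \<and> f x = \<zero>\<^bsub>N\<^esub>"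
  by (simp add: a_kernel_def kernel_def)

lemma submodule_a_kernel:
  assumes "f \<in> left_module_hom R M N" "left_module R M" "left_module R N"
  shows "submodule (a_kernel M N f) R M"
proof -
  interpret M: left_module R M by fact
  interpret N: left_module R N by fact
  show ?thesis
    using left_module_homD[OF assms(1)] left_module_hom_zero[OF assms]
    by (intro M.submoduleI) (auto simp: mem_a_kernel_iff M.smult_closed)
qed

lemma submodule_image:
  assumes "f \<in> left_module_hom R M N" "left_module R M" "left_module R N"
  shows "submodule (f ` carrier M) R N"
proof -
  interpret M: left_module R M by fact
  interpret N: left_module R N by fact
  note f = left_module_homD[OF assms(1)]
  show ?thesis
  proof (intro N.submoduleI)
    show "\<zero>\<^bsub>N\<^esub> \<in> f ` carrier M"
      using left_module_hom_zero[OF assms] by (metis M.M.zero_closed imageI)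
  qed (use f in \<open>auto simp: f(2,3)[symmetric] M.smult_closed intro!: imageI\<close>)
qed

text \<open>Every x is (x - s (q x)) + s (q x), and an element s y of the kernel has y = q (s y) =
  0. The two conclusions serve different notions: the kernel is what relative exactness asks to
  split over \<open>B\<close>, the image is what embeds a relatively projective module into a tensor
  product.\<close>

lemma direct_summand_split:
  assumes q: "q \<in> left_module_hom R M N" and s: "s \<in> left_module_hom R N M"
    and M: "left_module R M" and N: "left_module R N"
    and qs: "\<And>y. y \<in> carrier N \<Longrightarrow> q (s y) = y"
  shows "direct_summand R M (a_kernel M N q)" "direct_summand R M (s ` carrier N)"
proof -
  interpret M: left_module R M by fact
  interpret N: left_module R N by fact
  note q' = left_module_homD[OF q] and s' = left_module_homD[OF s]
  let ?K = "a_kernel M N q" and ?S = "s ` carrier N"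
  have sub: "submodule ?K R M" "submodule ?S R M"
    using submodule_a_kernel[OF q M N] submodule_image[OF s N M] by auto
  have int: "?K \<inter> ?S = {\<zero>\<^bsub>M\<^esub>}"
  proof -
    have "x = \<zero>\<^bsub>M\<^esub>" if "x \<in> ?K" "x \<in> ?S" for x
      using that qs left_module_hom_zero[OF s N M] by (auto simp: mem_a_kernel_iff)
    moreover have "\<zero>\<^bsub>M\<^esub> \<in> ?K" "\<zero>\<^bsub>M\<^esub> \<in> ?S"
      using sub[THEN submodule.axioms(1)] subgroup.one_closed by fastforce+
    ultimately show ?thesis by blast
  qed
  have sum: "?K <+>\<^bsub>M\<^esub> ?S = carrier M"
  proof (intro equalityI subsetI)
    fix x assume "x \<in> ?K <+>\<^bsub>M\<^esub> ?S"
    then show "x \<in> carrier M"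
      using s'(1) by (auto simp: set_add_def set_mult_def mem_a_kernel_iff)
  next
    fix x assume x: "x \<in> carrier M"
    define y where "y = s (q x)"
    have y: "y \<in> carrier M" "y \<in> ?S" "q y = q x"
      using x q' s' qs by (auto simp: y_def)
    have "q (x \<oplus>\<^bsub>M\<^esub> \<ominus>\<^bsub>M\<^esub> y) = \<zero>\<^bsub>N\<^esub>"
      using x y q' left_module_hom_a_inv[OF q M N] by (simp add: N.M.r_neg)
    then have "x \<oplus>\<^bsub>M\<^esub> \<ominus>\<^bsub>M\<^esub> y \<in> ?K"
      using x y by (simp add: mem_a_kernel_iff)
    moreover have "x = (x \<oplus>\<^bsub>M\<^esub> \<ominus>\<^bsub>M\<^esub> y) \<oplus>\<^bsub>M\<^esub> y"
      using x y by (simp add: M.M.a_assoc M.M.l_neg)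
    ultimately show "x \<in> ?K <+>\<^bsub>M\<^esub> ?S"
      using y(2) by (auto simp: set_add_def set_mult_def)
  qed
  \<comment> \<open>\<open>direct_summand\<close> takes the complement as the second term of the
    sum, so the case where the image is the summand needs the two terms exchanged.\<close>
  have "x \<oplus>\<^bsub>M\<^esub> y = y \<oplus>\<^bsub>M\<^esub> x" if "x \<in> ?S" "y \<in> ?K" for x y
    using that s'(1) M.M.a_comm by (auto simp: mem_a_kernel_iff)
  then have "?S <+>\<^bsub>M\<^esub> ?K = ?K <+>\<^bsub>M\<^esub> ?S"
    unfolding set_add_def set_mult_def by (subst SUP_commute) (intro SUP_cong refl, simp)
  then show "direct_summand R M ?K" "direct_summand R M ?S"
    unfolding direct_summand_def using sub int sum by blast+
qed

section \<open>Transport of structure along an injection\<close>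

definition transport_module :: "('m \<Rightarrow> 'n) \<Rightarrow> ('a, 'm, 'c) module_scheme \<Rightarrow> ('a, 'n) module" where
  "transport_module \<phi> M =
     (let \<psi> = inv_into (carrier M) \<phi>
      in \<lparr>carrier = \<phi> ` carrier M,
          monoid.mult = undefined,
          one = undefined,
          ring.zero = \<phi> \<zero>\<^bsub>M\<^esub>,
          add = (\<lambda>x y. \<phi> (\<psi> x \<oplus>\<^bsub>M\<^esub> \<psi> y)),
          module.smult = (\<lambda>a x. \<phi> (a \<odot>\<^bsub>M\<^esub> \<psi> x))\<rparr>)"

lemma
  assumes "left_module R M" and inj: "inj_on \<phi> (carrier M)"
  shows left_module_transport: "left_module R (transport_module \<phi> M)"
    and transport_hom: "\<phi> \<in> left_module_hom R M (transport_module \<phi> M)"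
    and transport_inv_hom:
      "inv_into (carrier M) \<phi> \<in> left_module_hom R (transport_module \<phi> M) M"
proof -
  interpret M: left_module R M by fact
  let ?\<psi> = "inv_into (carrier M) \<phi>" and ?N = "transport_module \<phi> M"
  note [simp] = inv_into_f_f[OF inj] M.smult_closed
  have N: "carrier ?N = \<phi> ` carrier M" "\<zero>\<^bsub>?N\<^esub> = \<phi> \<zero>\<^bsub>M\<^esub>"
    "\<And>x y. x \<oplus>\<^bsub>?N\<^esub> y = \<phi> (?\<psi> x \<oplus>\<^bsub>M\<^esub> ?\<psi> y)"
    "\<And>a x. a \<odot>\<^bsub>?N\<^esub> x = \<phi> (a \<odot>\<^bsub>M\<^esub> ?\<psi> x)"
    by (simp_all add: transport_module_def Let_def)
  have "abelian_group ?N"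
  proof (rule abelian_groupI)
    fix x assume "x \<in> carrier ?N"
    then show "\<exists>y\<in>carrier ?N. y \<oplus>\<^bsub>?N\<^esub> x = \<zero>\<^bsub>?N\<^esub>"
      by (auto simp: N M.M.l_neg intro!: bexI[of _ "\<ominus>\<^bsub>M\<^esub> _"])
  qed (auto simp: N M.M.a_ac)
  then show "left_module R ?N"
    by (intro left_module.intro left_module_axioms.intro M.R.ring_axioms)
      (auto simp: N M.smult_l_distr M.smult_r_distr M.smult_assoc M.smult_one)
  show "\<phi> \<in> left_module_hom R M ?N" "?\<psi> \<in> left_module_hom R ?N M"
    by (auto simp: left_module_hom_def N)
qed

section \<open>Tensor products\<close>

locale tensor = A?: ring A + V: left_module "A\<lparr>carrier := B\<rparr>" V
  for A :: "('a, 'r) ring_scheme" (structure) and B :: "'a set"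
    and V :: "('a, 'v, 'c) module_scheme" +
  assumes subring_B: "subring B A"
begin

abbreviation F :: "('a \<times> 'v \<Rightarrow>\<^sub>0 int) monoid" where
  "F \<equiv> free_Abelian_group (carrier A \<times> carrier V)"

definition N :: "('a \<times> 'v \<Rightarrow>\<^sub>0 int) set" where
  "N = generate F (tensor_relations A B V)"

abbreviation T :: "('a, ('a \<times> 'v \<Rightarrow>\<^sub>0 int) set) module" where
  "T \<equiv> tensor_product A B V"

definition tensor :: "'a \<Rightarrow> 'v \<Rightarrow> ('a \<times> 'v \<Rightarrow>\<^sub>0 int) set" where
  "tensor a v = N #>\<^bsub>F\<^esub> frag_of (a, v)"

lemma B_subset: "B \<subseteq> carrier A"
  using subring_B subringE(1) by blast

lemma B_closed [intro]: "b \<in> B \<Longrightarrow> b \<in> carrier A"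
  using B_subset by blast

lemma smult_B_closed: "b \<in> B \<Longrightarrow> v \<in> carrier V \<Longrightarrow> b \<odot>\<^bsub>V\<^esub> v \<in> carrier V"
  using V.smult_closed by simp

lemma keys_frag_of_sum:
  "x \<in> S \<Longrightarrow> y \<in> S \<Longrightarrow> z \<in> S \<Longrightarrow>
    Poly_Mapping.keys (frag_of x - frag_of y - frag_of z) \<subseteq> S"
  "x \<in> S \<Longrightarrow> y \<in> S \<Longrightarrow> Poly_Mapping.keys (frag_of x - frag_of y) \<subseteq> S"
  using keys_diff[of "frag_of x" "frag_of y"] keys_diff[of "frag_of x - frag_of y" "frag_of z"]
  by auto

lemma tensor_relations_subset: "tensor_relations A B V \<subseteq> carrier F"
proof
  fix r assume "r \<in> tensor_relations A B V"
  then show "r \<in> carrier F"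
    unfolding tensor_relations_def carrier_free_Abelian_group_iff
    by (elim UnE CollectE exE conjE; hypsubst; intro keys_frag_of_sum)
      (simp_all add: smult_B_closed B_closed)
qed

lemma subgroup_N: "subgroup N F"
  unfolding N_def by (rule group.generate_is_subgroup[OF group_free_Abelian_group tensor_relations_subset])

lemma relations_in_N:
  shows "\<lbrakk>a \<in> carrier A; a' \<in> carrier A; v \<in> carrier V\<rbrakk> \<Longrightarrow>
      frag_of (a \<oplus> a', v) - frag_of (a, v) - frag_of (a', v) \<in> N"
    and "\<lbrakk>a \<in> carrier A; v \<in> carrier V; v' \<in> carrier V\<rbrakk> \<Longrightarrow>
      frag_of (a, v \<oplus>\<^bsub>V\<^esub> v') - frag_of (a, v) - frag_of (a, v') \<in> N"
    and "\<lbrakk>a \<in> carrier A; b \<in> B; v \<in> carrier V\<rbrakk> \<Longrightarrow>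
      frag_of (a \<otimes> b, v) - frag_of (a, b \<odot>\<^bsub>V\<^esub> v) \<in> N"
  unfolding N_def tensor_relations_def by (rule generate.incl, blast)+

lemma N_zero: "0 \<in> N"
  using subgroup.one_closed[OF subgroup_N] by simp

lemma N_add: "x \<in> N \<Longrightarrow> y \<in> N \<Longrightarrow> x + y \<in> N"
  using subgroup.m_closed[OF subgroup_N] by simp

lemma N_keys: "x \<in> N \<Longrightarrow> Poly_Mapping.keys x \<subseteq> carrier A \<times> carrier V"
  using subgroup.mem_carrier[OF subgroup_N, of x] by simp

lemma N_minus: "x \<in> N \<Longrightarrow> - x \<in> N"
  using subgroup.m_inv_closed[OF subgroup_N, of x] N_keys[of x] by simp

text \<open>Group multiplication in \<open>F\<close> is addition of finitely supported functions, so
  membership in a coset becomes a statement about an ordinary difference.\<close>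

lemma mem_coset_iff: "x \<in> N #>\<^bsub>F\<^esub> f \<longleftrightarrow> x - f \<in> N"
proof
  assume "x - f \<in> N"
  then show "x \<in> N #>\<^bsub>F\<^esub> f"
    unfolding r_coset_def by (intro UN_I[of "x - f"]) simp_all
qed (auto simp: r_coset_def)

lemma coset_eq_iff: "N #>\<^bsub>F\<^esub> f = N #>\<^bsub>F\<^esub> g \<longleftrightarrow> f - g \<in> N"
proof
  assume "N #>\<^bsub>F\<^esub> f = N #>\<^bsub>F\<^esub> g"
  then show "f - g \<in> N"
    using mem_coset_iff[of f f] N_zero by (simp add: mem_coset_iff)
next
  assume fg: "f - g \<in> N"
  have "x - f \<in> N \<longleftrightarrow> x - g \<in> N" for x
    using N_add[OF _ fg, of "x - f"] N_add[OF _ N_minus[OF fg], of "x - g"] by auto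
  then show "N #>\<^bsub>F\<^esub> f = N #>\<^bsub>F\<^esub> g"
    by (simp add: set_eq_iff mem_coset_iff)
qed

lemma carrier_tensor_product: "carrier T = {N #>\<^bsub>F\<^esub> f | f. Poly_Mapping.keys f \<subseteq> carrier A \<times> carrier V}"
  by (auto simp: tensor_product_def Let_def FactGroup_def RCOSETS_def N_def)

lemma add_tensor_product:
  assumes "Poly_Mapping.keys f \<subseteq> carrier A \<times> carrier V" "Poly_Mapping.keys g \<subseteq> carrier A \<times> carrier V"
  shows "(N #>\<^bsub>F\<^esub> f) \<oplus>\<^bsub>T\<^esub> (N #>\<^bsub>F\<^esub> g) = N #>\<^bsub>F\<^esub> (f + g)"
proof -
  have "normal N F"
    using comm_group.normal_iff_subgroup[OF abelian_free_Abelian_group] subgroup_N by blast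
  then show ?thesis
    using normal.rcos_sum[of N F f g] assms by (simp add: tensor_product_def Let_def FactGroup_def N_def)
qed

lemma zero_tensor_product: "\<zero>\<^bsub>T\<^esub> = N #>\<^bsub>F\<^esub> 0"
  using group.coset_mult_one[OF group_free_Abelian_group, of N] subgroup.subset[OF subgroup_N]
  by (simp add: tensor_product_def Let_def FactGroup_def N_def)

lemma keys_add_subset:
  "Poly_Mapping.keys f \<subseteq> S \<Longrightarrow> Poly_Mapping.keys g \<subseteq> S \<Longrightarrow> Poly_Mapping.keys (f + g) \<subseteq> S"
  using keys_add[of f g] by blast

lemma tensor_product_cases:
  assumes "x \<in> carrier T"
  obtains f where "Poly_Mapping.keys f \<subseteq> carrier A \<times> carrier V" "x = N #>\<^bsub>F\<^esub> f"
  using assms carrier_tensor_product by auto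

lemma coset_closed:
  "Poly_Mapping.keys f \<subseteq> carrier A \<times> carrier V \<Longrightarrow> N #>\<^bsub>F\<^esub> f \<in> carrier T"
  using carrier_tensor_product by auto

lemma abelian_group_tensor_product: "abelian_group T"
proof (rule abelian_groupI)
  show "\<zero>\<^bsub>T\<^esub> \<in> carrier T"
    by (simp add: zero_tensor_product coset_closed)
  show "x \<oplus>\<^bsub>T\<^esub> y \<in> carrier T" if "x \<in> carrier T" "y \<in> carrier T" for x y
    using that by (elim tensor_product_cases) (simp add: add_tensor_product coset_closed keys_add_subset)
  show "x \<oplus>\<^bsub>T\<^esub> y \<oplus>\<^bsub>T\<^esub> z = x \<oplus>\<^bsub>T\<^esub> (y \<oplus>\<^bsub>T\<^esub> z)"
    if "x \<in> carrier T" "y \<in> carrier T" "z \<in> carrier T" for x y z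
    using that by (elim tensor_product_cases) (simp add: add_tensor_product keys_add_subset add.assoc)
  show "x \<oplus>\<^bsub>T\<^esub> y = y \<oplus>\<^bsub>T\<^esub> x" if "x \<in> carrier T" "y \<in> carrier T" for x y
    using that by (elim tensor_product_cases) (simp add: add_tensor_product add.commute)
  show "\<zero>\<^bsub>T\<^esub> \<oplus>\<^bsub>T\<^esub> x = x" if "x \<in> carrier T" for x
    using that by (elim tensor_product_cases) (simp add: add_tensor_product zero_tensor_product)
  show "\<exists>y\<in>carrier T. y \<oplus>\<^bsub>T\<^esub> x = \<zero>\<^bsub>T\<^esub>" if x: "x \<in> carrier T" for x
  proof -
    obtain f where f: "Poly_Mapping.keys f \<subseteq> carrier A \<times> carrier V" "x = N #>\<^bsub>F\<^esub> f"
      using x by (rule tensor_product_cases)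
    then have "N #>\<^bsub>F\<^esub> (- f) \<in> carrier T" "(N #>\<^bsub>F\<^esub> (- f)) \<oplus>\<^bsub>T\<^esub> x = \<zero>\<^bsub>T\<^esub>"
      by (simp_all add: add_tensor_product zero_tensor_product coset_closed)
    then show ?thesis by blast
  qed
qed

sublocale T: abelian_group T
  by (rule abelian_group_tensor_product)

abbreviation scale :: "'a \<Rightarrow> ('a \<times> 'v \<Rightarrow>\<^sub>0 int) \<Rightarrow> ('a \<times> 'v \<Rightarrow>\<^sub>0 int)" where
  "scale a \<equiv> frag_extend (\<lambda>(a', v). frag_of (a \<otimes> a', v))"

lemma keys_scale:
  assumes "a \<in> carrier A" "Poly_Mapping.keys f \<subseteq> carrier A \<times> carrier V"
  shows "Poly_Mapping.keys (scale a f) \<subseteq> carrier A \<times> carrier V"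
  using assms(2)
proof (induction f rule: free_Abelian_group_induct[consumes 1, case_names zero diff frag])
  case (diff x y)
  then show ?case
    using keys_diff[of "scale a x" "scale a y"] by (auto simp: frag_extend_diff)
qed (use assms(1) in auto)

text \<open>Left multiplication by a turns each of the three kinds of relations into a relation of
  the same kind, and the elements sent into \<open>N\<close> form a subgroup. This makes the action
  of a on cosets well defined.\<close>

lemma scale_in_N:
  assumes a: "a \<in> carrier A" and f: "f \<in> N" shows "scale a f \<in> N"
proof -
  let ?K = "{f \<in> carrier F. scale a f \<in> N}"
  have "subgroup ?K F"
    using keys_add by (intro group.subgroupI)
      (fastforce simp: frag_extend_add frag_extend_minus intro: N_zero N_add N_minus)+
  moreover have "scale a r \<in> N" if "r \<in> tensor_relations A B V" for r
    using that unfolding tensor_relations_def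
  proof (elim UnE CollectE exE conjE, goal_cases)
    case (1 x y v)
    then show ?case using a relations_in_N(1)[of "a \<otimes> x" "a \<otimes> y" v] by (simp add: frag_extend_diff r_distr)
  next
    case (2 x v w)
    then show ?case using a relations_in_N(2)[of "a \<otimes> x" v w] by (simp add: frag_extend_diff)
  next
    case (3 x b v)
    then show ?case
      using a relations_in_N(3)[of "a \<otimes> x" b v] by (simp add: frag_extend_diff m_assoc B_closed)
  qed
  ultimately have "generate F (tensor_relations A B V) \<subseteq> ?K"
    using tensor_relations_subset group.generate_subgroup_incl[OF group_free_Abelian_group, of _ ?K]
    by blast
  then show ?thesis using f by (auto simp: N_def)
qed

text \<open>Representatives of one coset differ by an element of \<open>N\<close>, and
  \<open>scale a\<close> keeps it in \<open>N\<close>. So the union in the definition of the action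
  collapses to one coset.\<close>

lemma smult_tensor_product:
  assumes a: "a \<in> carrier A" and f: "Poly_Mapping.keys f \<subseteq> carrier A \<times> carrier V"
  shows "a \<odot>\<^bsub>T\<^esub> (N #>\<^bsub>F\<^esub> f) = N #>\<^bsub>F\<^esub> scale a f"
proof -
  have "N #>\<^bsub>F\<^esub> scale a g = N #>\<^bsub>F\<^esub> scale a f" if "g \<in> N #>\<^bsub>F\<^esub> f" for g
    using that scale_in_N[OF a, of "g - f"] by (simp add: coset_eq_iff mem_coset_iff frag_extend_diff)
  moreover have "f \<in> N #>\<^bsub>F\<^esub> f" by (simp add: mem_coset_iff N_zero)
  ultimately have "(\<Union>g\<in>N #>\<^bsub>F\<^esub> f. N #>\<^bsub>F\<^esub> scale a g) = N #>\<^bsub>F\<^esub> scale a f" by blast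
  then show ?thesis by (simp add: tensor_product_def Let_def N_def)
qed

lemma tensor_closed [intro, simp]: "a \<in> carrier A \<Longrightarrow> v \<in> carrier V \<Longrightarrow> tensor a v \<in> carrier T"
  unfolding carrier_tensor_product tensor_def by (auto intro!: exI[of _ "frag_of (a, v)"])

lemma tensor_add_left:
  assumes "a \<in> carrier A" "a' \<in> carrier A" "v \<in> carrier V"
  shows "tensor (a \<oplus> a') v = tensor a v \<oplus>\<^bsub>T\<^esub> tensor a' v"
  using assms relations_in_N(1)[OF assms]
  by (simp add: tensor_def add_tensor_product coset_eq_iff diff_diff_eq)

lemma tensor_add_right:
  assumes "a \<in> carrier A" "v \<in> carrier V" "v' \<in> carrier V"
  shows "tensor a (v \<oplus>\<^bsub>V\<^esub> v') = tensor a v \<oplus>\<^bsub>T\<^esub> tensor a v'"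
  using assms relations_in_N(2)[OF assms]
  by (simp add: tensor_def add_tensor_product coset_eq_iff diff_diff_eq)

lemma tensor_balanced:
  assumes "a \<in> carrier A" "b \<in> B" "v \<in> carrier V"
  shows "tensor (a \<otimes> b) v = tensor a (b \<odot>\<^bsub>V\<^esub> v)"
  using relations_in_N(3)[OF assms] by (simp add: tensor_def coset_eq_iff)

lemma smult_tensor:
  assumes "a \<in> carrier A" "a' \<in> carrier A" "v \<in> carrier V"
  shows "a \<odot>\<^bsub>T\<^esub> tensor a' v = tensor (a \<otimes> a') v"
  using assms by (simp add: tensor_def smult_tensor_product)

lemma tensor_zero_right [simp]:
  assumes "a \<in> carrier A" shows "tensor a \<zero>\<^bsub>V\<^esub> = \<zero>\<^bsub>T\<^esub>"
  using tensor_add_right[of a "\<zero>\<^bsub>V\<^esub>" "\<zero>\<^bsub>V\<^esub>"] assms T.add.r_cancel_one by simp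

lemma tensor_zero_left [simp]:
  assumes "v \<in> carrier V" shows "tensor \<zero> v = \<zero>\<^bsub>T\<^esub>"
  using tensor_add_left[of \<zero> \<zero> v] assms T.add.r_cancel_one by simp

text \<open>Elementary tensors generate the tensor product under addition alone, because -(a
  \<otimes> v) = a \<otimes> (-v).\<close>

lemma tensor_induct [consumes 1, case_names zero tensor add]:
  assumes x: "x \<in> carrier T"
    and zero: "P \<zero>\<^bsub>T\<^esub>"
    and tensor: "\<And>a v. a \<in> carrier A \<Longrightarrow> v \<in> carrier V \<Longrightarrow> P (tensor a v)"
    and add: "\<And>x y. x \<in> carrier T \<Longrightarrow> y \<in> carrier T \<Longrightarrow> P x \<Longrightarrow> P y \<Longrightarrow> P (x \<oplus>\<^bsub>T\<^esub> y)"
  shows "P x"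
proof -
  obtain f where f: "Poly_Mapping.keys f \<subseteq> carrier A \<times> carrier V" "x = N #>\<^bsub>F\<^esub> f"
    using x by (rule tensor_product_cases)
  \<comment> \<open>The induction over the free abelian group has a difference step, whereas
    \<open>P\<close> is only known to pass to sums. Carrying the claim for -f along turns y - z into
    y + (-z).\<close>
  have "P (N #>\<^bsub>F\<^esub> f) \<and> P (N #>\<^bsub>F\<^esub> (- f))"
    using f(1)
  proof (induction f rule: free_Abelian_group_induct[consumes 1, case_names zero diff frag])
    case zero
    then show ?case using assms(2) zero_tensor_product by simp
  next
    case (diff y z)
    have "P (N #>\<^bsub>F\<^esub> (y + - z))" "P (N #>\<^bsub>F\<^esub> (- y + z))"
      using diff add[of "N #>\<^bsub>F\<^esub> y" "N #>\<^bsub>F\<^esub> (- z)"] add[of "N #>\<^bsub>F\<^esub> (- y)" "N #>\<^bsub>F\<^esub> z"]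
      by (simp_all add: add_tensor_product coset_closed)
    then show ?case by simp
  next
    case (frag p)
    then obtain a v where p: "p = (a, v)" "a \<in> carrier A" "v \<in> carrier V" by auto
    have inv: "tensor a (\<ominus>\<^bsub>V\<^esub> v) \<oplus>\<^bsub>T\<^esub> tensor a v = \<zero>\<^bsub>T\<^esub>"
      using p tensor_add_right[of a "\<ominus>\<^bsub>V\<^esub> v" v] by (simp add: V.M.l_neg)
    have "N #>\<^bsub>F\<^esub> (- frag_of p) = (N #>\<^bsub>F\<^esub> (- frag_of p)) \<oplus>\<^bsub>T\<^esub> (tensor a v \<oplus>\<^bsub>T\<^esub> tensor a (\<ominus>\<^bsub>V\<^esub> v))"
      using p inv coset_closed[of "- frag_of p"] by (simp add: T.a_comm)
    also have "\<dots> = ((N #>\<^bsub>F\<^esub> (- frag_of p)) \<oplus>\<^bsub>T\<^esub> tensor a v) \<oplus>\<^bsub>T\<^esub> tensor a (\<ominus>\<^bsub>V\<^esub> v)"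
      using p coset_closed[of "- frag_of p"] by (simp add: T.a_assoc)
    also have "(N #>\<^bsub>F\<^esub> (- frag_of p)) \<oplus>\<^bsub>T\<^esub> tensor a v = \<zero>\<^bsub>T\<^esub>"
      using p by (simp add: tensor_def add_tensor_product zero_tensor_product)
    finally have "N #>\<^bsub>F\<^esub> (- frag_of p) = tensor a (\<ominus>\<^bsub>V\<^esub> v)"
      using p by simp
    then show ?case using p tensor[of a v] tensor[of a "\<ominus>\<^bsub>V\<^esub> v"] by (simp add: tensor_def)
  qed
  then show ?thesis using f(2) by simp
qed

sublocale T: left_module A T
proof (intro left_module.intro left_module_axioms.intro A.ring_axioms T.abelian_group_axioms)
  have closed: "a \<odot>\<^bsub>T\<^esub> x \<in> carrier T" if "a \<in> carrier A" "x \<in> carrier T" for a x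
    using that by (elim tensor_product_cases) (simp add: smult_tensor_product keys_scale coset_closed)
  have r_distr: "a \<odot>\<^bsub>T\<^esub> (x \<oplus>\<^bsub>T\<^esub> y) = a \<odot>\<^bsub>T\<^esub> x \<oplus>\<^bsub>T\<^esub> a \<odot>\<^bsub>T\<^esub> y"
    if a: "a \<in> carrier A" and xy: "x \<in> carrier T" "y \<in> carrier T" for a x y
  proof -
    obtain f g where f: "Poly_Mapping.keys f \<subseteq> carrier A \<times> carrier V" "x = N #>\<^bsub>F\<^esub> f"
      and g: "Poly_Mapping.keys g \<subseteq> carrier A \<times> carrier V" "y = N #>\<^bsub>F\<^esub> g"
      using xy by (elim tensor_product_cases)
    then show ?thesis
      using a by (simp add: add_tensor_product smult_tensor_product keys_scale keys_add_subset frag_extend_add)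
  qed
  have zero: "a \<odot>\<^bsub>T\<^esub> \<zero>\<^bsub>T\<^esub> = \<zero>\<^bsub>T\<^esub>" if "a \<in> carrier A" for a
    using that by (simp add: zero_tensor_product smult_tensor_product)
  show "a \<odot>\<^bsub>T\<^esub> x \<in> carrier T" if "a \<in> carrier A" "x \<in> carrier T" for a x
    using closed that by blast
  show "a \<odot>\<^bsub>T\<^esub> (x \<oplus>\<^bsub>T\<^esub> y) = a \<odot>\<^bsub>T\<^esub> x \<oplus>\<^bsub>T\<^esub> a \<odot>\<^bsub>T\<^esub> y"
    if "a \<in> carrier A" "x \<in> carrier T" "y \<in> carrier T" for a x y
    using r_distr that by blast
  show "(a \<oplus> b) \<odot>\<^bsub>T\<^esub> x = a \<odot>\<^bsub>T\<^esub> x \<oplus>\<^bsub>T\<^esub> b \<odot>\<^bsub>T\<^esub> x"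
    if ab: "a \<in> carrier A" "b \<in> carrier A" and "x \<in> carrier T" for a b x
    using that(3)
    by (induction rule: tensor_induct)
      (use ab in \<open>simp_all add: zero smult_tensor l_distr tensor_add_left r_distr closed T.a_ac\<close>)
  show "(a \<otimes> b) \<odot>\<^bsub>T\<^esub> x = a \<odot>\<^bsub>T\<^esub> (b \<odot>\<^bsub>T\<^esub> x)"
    if ab: "a \<in> carrier A" "b \<in> carrier A" and "x \<in> carrier T" for a b x
    using that(3)
    by (induction rule: tensor_induct) (use ab in \<open>simp_all add: zero smult_tensor m_assoc r_distr closed\<close>)
  show "\<one> \<odot>\<^bsub>T\<^esub> x = x" if "x \<in> carrier T" for x
    using that by (induction rule: tensor_induct) (simp_all add: zero smult_tensor r_distr)
qed

text \<open>The adjunction between induction and restriction: a \<open>B\<close>-linear map out of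
  \<open>V\<close> extends to an A-linear map out of the tensor product. Both \<mu> and \<pi> arise
  in this way.\<close>

lemma tensor_lift:
  assumes W: "left_module A W" and g: "g \<in> left_module_hom (A\<lparr>carrier := B\<rparr>) V W"
  obtains h where "h \<in> left_module_hom A T W"
    "\<And>a v. a \<in> carrier A \<Longrightarrow> v \<in> carrier V \<Longrightarrow> h (tensor a v) = a \<odot>\<^bsub>W\<^esub> g v"
proof -
  interpret W: left_module A W by fact
  note g = left_module_homD[OF g, simplified]
  obtain h0 where h0: "h0 \<in> hom F (add_monoid W)"
    "\<And>p. p \<in> carrier A \<times> carrier V \<Longrightarrow> h0 (frag_of p) = (\<lambda>(a, v). a \<odot>\<^bsub>W\<^esub> g v) p"
    using comm_group.free_Abelian_group_universal[OF W.M.a_comm_group,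
        of "\<lambda>(a, v). a \<odot>\<^bsub>W\<^esub> g v" "carrier A \<times> carrier V"] g(1) W.smult_closed
    by (auto simp: image_subset_iff)
  interpret h0: group_hom F "add_monoid W" h0
    by (intro group_hom.intro group_hom_axioms.intro h0(1) W.M.a_group group_free_Abelian_group)
  have h0_frag: "h0 (frag_of (a, v)) = a \<odot>\<^bsub>W\<^esub> g v" if "a \<in> carrier A" "v \<in> carrier V" for a v
    using h0(2)[of "(a, v)"] that by simp
  have h0_closed: "h0 f \<in> carrier W" if "Poly_Mapping.keys f \<subseteq> carrier A \<times> carrier V" for f
    using h0.hom_closed that by simp
  have h0_add: "h0 (x + y) = h0 x \<oplus>\<^bsub>W\<^esub> h0 y"
    if "Poly_Mapping.keys x \<subseteq> carrier A \<times> carrier V" "Poly_Mapping.keys y \<subseteq> carrier A \<times> carrier V" for x y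
    using h0.hom_mult[of x y] that by simp
  have h0_diff: "h0 (x - y) = h0 x \<ominus>\<^bsub>W\<^esub> h0 y"
    if "Poly_Mapping.keys x \<subseteq> carrier A \<times> carrier V" "Poly_Mapping.keys y \<subseteq> carrier A \<times> carrier V" for x y
    using h0_add[of x "- y"] h0.hom_inv[of y] that by (simp add: a_minus_def a_inv_def)
  have cancel: "x \<oplus>\<^bsub>W\<^esub> y \<ominus>\<^bsub>W\<^esub> x \<ominus>\<^bsub>W\<^esub> y = \<zero>\<^bsub>W\<^esub>" if "x \<in> carrier W" "y \<in> carrier W" for x y
    using that W.M.r_neg[of "x \<oplus>\<^bsub>W\<^esub> y"] by (simp add: W.M.minus_eq W.M.minus_add W.M.a_assoc)
  \<comment> \<open>The first two kinds of relations vanish by distributivity and additivity of g,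
    the third by the \<open>B\<close>-linearity of g.\<close>
  have "h0 r = \<zero>\<^bsub>W\<^esub>" if "r \<in> tensor_relations A B V" for r
    using that unfolding tensor_relations_def
  proof (elim UnE CollectE exE conjE, goal_cases)
    case (1 a b v)
    then show ?case
      by (simp add: h0_diff keys_frag_of_sum h0_frag W.smult_l_distr W.smult_closed g cancel)
  next
    case (2 a v w)
    then show ?case
      by (simp add: h0_diff keys_frag_of_sum h0_frag W.smult_r_distr W.smult_closed g cancel)
  next
    case (3 a b v)
    then show ?case
      by (simp add: h0_diff keys_frag_of_sum h0_frag W.smult_assoc W.smult_closed g B_closed
          smult_B_closed W.M.minus_eq W.M.r_neg)
  qed
  then have "tensor_relations A B V \<subseteq> kernel F (add_monoid W) h0"
    using tensor_relations_subset by (auto simp del: carrier_free_Abelian_group_iff simp: kernel_def)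
  then have "N \<subseteq> kernel F (add_monoid W) h0"
    unfolding N_def using h0.subgroup_kernel
    by (intro group.generate_subgroup_incl[OF group_free_Abelian_group])
  then have h0_N: "h0 x = \<zero>\<^bsub>W\<^esub>" if "x \<in> N" for x
    using that by (auto simp: kernel_def)
  \<comment> \<open>\<open>h0\<close> is constant on each coset of \<open>N\<close>, so the image of
    a coset is a singleton.\<close>
  define h where "h X = the_elem (h0 ` X)" for X
  have h_coset: "h (N #>\<^bsub>F\<^esub> f) = h0 f" if f: "Poly_Mapping.keys f \<subseteq> carrier A \<times> carrier V" for f
  proof -
    have "h0 x = h0 f" if "x \<in> N #>\<^bsub>F\<^esub> f" for x
      using h0_add[of "x - f" f] that f N_keys h0_N h0_closed[OF f] by (simp add: mem_coset_iff)
    moreover have "f \<in> N #>\<^bsub>F\<^esub> f" by (simp add: mem_coset_iff N_zero)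
    ultimately have "h0 ` (N #>\<^bsub>F\<^esub> f) = {h0 f}" by blast
    then show ?thesis by (simp add: h_def)
  qed
  have h_tensor: "h (tensor a v) = a \<odot>\<^bsub>W\<^esub> g v" if "a \<in> carrier A" "v \<in> carrier V" for a v
    using that by (simp add: tensor_def h_coset h0_frag)
  have h_closed: "h x \<in> carrier W" if "x \<in> carrier T" for x
    using that by (elim tensor_product_cases) (simp add: h_coset h0_closed)
  have h_add: "h (x \<oplus>\<^bsub>T\<^esub> y) = h x \<oplus>\<^bsub>W\<^esub> h y" if xy: "x \<in> carrier T" "y \<in> carrier T" for x y
  proof -
    obtain f f' where f: "Poly_Mapping.keys f \<subseteq> carrier A \<times> carrier V" "x = N #>\<^bsub>F\<^esub> f"
      and f': "Poly_Mapping.keys f' \<subseteq> carrier A \<times> carrier V" "y = N #>\<^bsub>F\<^esub> f'"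
      using xy by (elim tensor_product_cases)
    then show ?thesis by (simp add: add_tensor_product keys_add_subset h_coset h0_add)
  qed
  have h_zero: "h \<zero>\<^bsub>T\<^esub> = \<zero>\<^bsub>W\<^esub>"
    using zero_tensor_product h_coset[of 0] h0_N[OF N_zero] by simp
  have h_smult: "h (a \<odot>\<^bsub>T\<^esub> x) = a \<odot>\<^bsub>W\<^esub> h x" if a: "a \<in> carrier A" and x: "x \<in> carrier T" for a x
    using x
  proof (induction rule: tensor_induct)
    case zero
    then show ?case using a by (simp add: h_zero)
  next
    case (tensor a' v)
    then show ?case using a by (simp add: smult_tensor h_tensor W.smult_assoc g)
  next
    case (add x y)
    then show ?case
      using a by (simp add: T.smult_r_distr h_add T.smult_closed W.smult_r_distr h_closed)
  qed
  show thesis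
    using that[of h] left_module_homI[of T h W A] h_closed h_add h_smult h_tensor by blast
qed

lemma lepoll_tensor_product: "carrier T \<lesssim> carrier F"
proof -
  have "carrier T \<subseteq> (\<lambda>f. N #>\<^bsub>F\<^esub> f) ` carrier F"
    by (auto simp: carrier_tensor_product)
  then show ?thesis by (rule subset_image_lepoll)
qed

end

section \<open>Splitting along orthogonal idempotents\<close>

text \<open>The vertices enter here only as a complete system of orthogonal idempotents. The
  \<open>B\<close>-module that is induced up is the restriction of the A-module
  \<open>M\<close>.\<close>

locale idempotent_tensor = A?: ring A + M: left_module A M
  for A :: "('a, 'r) ring_scheme" (structure) and B :: "'a set" and M :: "('a, 'm) module" +
  fixes E :: "'i set" and e :: "'i \<Rightarrow> 'a"
  assumes subring: "subring B A"
    and finite_E: "finite E"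
    and e_closed [simp, intro]: "i \<in> E \<Longrightarrow> e i \<in> carrier A"
    and e_mult: "i \<in> E \<Longrightarrow> j \<in> E \<Longrightarrow> e i \<otimes> e j = (if i = j then e i else \<zero>)"
    and e_sum: "(\<Oplus>i\<in>E. e i) = \<one>"
begin

sublocale tensor A B M
  by (intro tensor.intro tensor_axioms.intro A.ring_axioms M.restrict_scalars subring)

declare M.smult_closed [simp] T.smult_closed [simp]

text \<open>A retract of \<open>A \<otimes>\<^sub>B M\<close> is relatively projective. The witness
  for the inducing \<open>B\<close>-module is \<open>M\<close> itself, which lives in the required
  type.\<close>

lemma rel_projectiveI:
  assumes P: "left_module A (P :: ('a, 'm) module)"
    and s: "s \<in> left_module_hom A P T" and r: "r \<in> left_module_hom A T P"
    and rs: "\<And>x. x \<in> carrier P \<Longrightarrow> r (s x) = x"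
  shows "rel_projective A B P"
proof -
  have "direct_summand A T (s ` carrier P)"
    by (rule direct_summand_split(2)[OF r s T.left_module_axioms P rs])
  moreover have "inj_on s (carrier P)"
    by (rule inj_on_inverseI) (rule rs)
  then have "bij_betw s (carrier P) (s ` carrier P)"
    by (rule inj_on_imp_bij_betw)
  ultimately have "\<exists>H f. direct_summand A T H \<and> f \<in> left_module_hom A P T \<and> bij_betw f (carrier P) H"
    using s by blast
  then show ?thesis
    unfolding rel_projective_def using P V.left_module_axioms by blast
qed

lemma e_smult:
  assumes "i \<in> E" "j \<in> E" "m \<in> carrier M"
  shows "e i \<odot>\<^bsub>M\<^esub> (e j \<odot>\<^bsub>M\<^esub> m) = (if i = j then e i \<odot>\<^bsub>M\<^esub> m else \<zero>\<^bsub>M\<^esub>)"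
  using assms by (simp add: M.smult_assoc[symmetric] e_mult)

lemma sum_e_smult: "m \<in> carrier M \<Longrightarrow> (\<Oplus>\<^bsub>M\<^esub>i\<in>E. e i \<odot>\<^bsub>M\<^esub> m) = m"
  using M.finsum_smult[of e E m] by (simp add: e_sum M.smult_one Pi_iff)

lemma sum_e_smult_T: "x \<in> carrier T \<Longrightarrow> (\<Oplus>\<^bsub>T\<^esub>i\<in>E. e i \<odot>\<^bsub>T\<^esub> x) = x"
  using T.finsum_smult[of e E x] by (simp add: e_sum T.smult_one Pi_iff)

lemma tensor_finsum_right:
  assumes "a \<in> carrier A" "f \<in> S \<rightarrow> carrier M"
  shows "tensor a (\<Oplus>\<^bsub>M\<^esub>i\<in>S. f i) = (\<Oplus>\<^bsub>T\<^esub>i\<in>S. tensor a (f i))"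
  using assms(2)
proof (induction S rule: infinite_finite_induct)
  case (insert i S)
  then have "f i \<in> carrier M" "f \<in> S \<rightarrow> carrier M" by auto
  moreover have "(\<lambda>i. tensor a (f i)) \<in> S \<rightarrow> carrier T"
    using calculation assms(1) by auto
  ultimately show ?case
    using insert assms(1) by (simp add: tensor_add_right)
qed (simp_all add: assms(1))

text \<open>The obvious section m \<mapsto> 1 \<otimes> m is \<open>B\<close>-linear but need not
  commute with an idempotent e outside \<open>B\<close>, as e \<otimes> m and 1 \<otimes> e m may
  differ. Cutting both factors by the idempotents restores this: e \<sigma>(m) = e \<otimes> e m =
  \<sigma>(e m). The price is that \<open>B\<close>-linearity now has to be proved.\<close>

definition section_map :: "'m \<Rightarrow> ('a \<times> 'm \<Rightarrow>\<^sub>0 int) set" (\<open>\<sigma>\<close>) where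
  "\<sigma> m = (\<Oplus>\<^bsub>T\<^esub>i\<in>E. tensor (e i) (e i \<odot>\<^bsub>M\<^esub> m))"

lemma sigma_closed [simp, intro]: "m \<in> carrier M \<Longrightarrow> \<sigma> m \<in> carrier T"
  unfolding section_map_def by (intro T.finsum_closed) auto

lemma sigma_add:
  assumes "m \<in> carrier M" "m' \<in> carrier M"
  shows "\<sigma> (m \<oplus>\<^bsub>M\<^esub> m') = \<sigma> m \<oplus>\<^bsub>T\<^esub> \<sigma> m'"
proof -
  have "\<sigma> (m \<oplus>\<^bsub>M\<^esub> m') = (\<Oplus>\<^bsub>T\<^esub>i\<in>E. tensor (e i) (e i \<odot>\<^bsub>M\<^esub> m) \<oplus>\<^bsub>T\<^esub> tensor (e i) (e i \<odot>\<^bsub>M\<^esub> m'))"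
    unfolding section_map_def using assms
    by (intro T.finsum_cong' refl) (auto simp: M.smult_r_distr tensor_add_right)
  also have "\<dots> = \<sigma> m \<oplus>\<^bsub>T\<^esub> \<sigma> m'"
    unfolding section_map_def using assms by (intro T.finsum_addf) auto
  finally show ?thesis .
qed

lemma sigma_zero [simp]: "\<sigma> \<zero>\<^bsub>M\<^esub> = \<zero>\<^bsub>T\<^esub>"
  using sigma_add[of "\<zero>\<^bsub>M\<^esub>" "\<zero>\<^bsub>M\<^esub>"] T.add.r_cancel_one by simp

lemma sigma_minus: "m \<in> carrier M \<Longrightarrow> \<sigma> (\<ominus>\<^bsub>M\<^esub> m) = \<ominus>\<^bsub>T\<^esub> \<sigma> m"
  using sigma_add[of "\<ominus>\<^bsub>M\<^esub> m" m] T.minus_equality[of "\<sigma> (\<ominus>\<^bsub>M\<^esub> m)" "\<sigma> m"] by (simp add: M.l_neg)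

lemma smult_sigma:
  assumes "a \<in> carrier A" "m \<in> carrier M"
  shows "a \<odot>\<^bsub>T\<^esub> \<sigma> m = (\<Oplus>\<^bsub>T\<^esub>i\<in>E. tensor (a \<otimes> e i) (e i \<odot>\<^bsub>M\<^esub> m))"
proof -
  have "a \<odot>\<^bsub>T\<^esub> \<sigma> m = (\<Oplus>\<^bsub>T\<^esub>i\<in>E. a \<odot>\<^bsub>T\<^esub> tensor (e i) (e i \<odot>\<^bsub>M\<^esub> m))"
    unfolding section_map_def using assms by (intro T.smult_finsum) auto
  also have "\<dots> = (\<Oplus>\<^bsub>T\<^esub>i\<in>E. tensor (a \<otimes> e i) (e i \<odot>\<^bsub>M\<^esub> m))"
    using assms by (intro T.finsum_cong' refl) (auto simp: smult_tensor)
  finally show ?thesis .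
qed

text \<open>These elements form a subring, so \<open>B\<close> lies among them as soon as its
  generators and the scalars do.\<close>

definition linear_scalars :: "'a set" where
  "linear_scalars = {a \<in> carrier A. \<forall>m\<in>carrier M. \<sigma> (a \<odot>\<^bsub>M\<^esub> m) = a \<odot>\<^bsub>T\<^esub> \<sigma> m}"

lemma linear_scalarsD:
  "a \<in> linear_scalars \<Longrightarrow> a \<in> carrier A"
  "a \<in> linear_scalars \<Longrightarrow> m \<in> carrier M \<Longrightarrow> \<sigma> (a \<odot>\<^bsub>M\<^esub> m) = a \<odot>\<^bsub>T\<^esub> \<sigma> m"
  by (auto simp: linear_scalars_def)

lemma subring_linear_scalars: "subring linear_scalars A"
proof (intro A.subringI)
  show "\<one> \<in> linear_scalars"
    by (simp add: linear_scalars_def M.smult_one T.smult_one)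
  show "\<ominus> a \<in> linear_scalars" if "a \<in> linear_scalars" for a
    using that by (auto simp: linear_scalars_def M.a_inv_smult T.a_inv_smult sigma_minus)
  show "a \<otimes> b \<in> linear_scalars" if "a \<in> linear_scalars" "b \<in> linear_scalars" for a b
    using that by (auto simp: linear_scalars_def M.smult_assoc T.smult_assoc)
  show "a \<oplus> b \<in> linear_scalars" if "a \<in> linear_scalars" "b \<in> linear_scalars" for a b
    using that by (auto simp: linear_scalars_def M.smult_l_distr T.smult_l_distr sigma_add)
qed (auto simp: linear_scalars_def)

text \<open>Orthogonality leaves only the summand with index j on either side.\<close>

lemma
  assumes j: "j \<in> E" and m: "m \<in> carrier M"
  shows e_smult_sigma: "e j \<odot>\<^bsub>T\<^esub> \<sigma> m = tensor (e j) (e j \<odot>\<^bsub>M\<^esub> m)"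
    and sigma_e_smult: "\<sigma> (e j \<odot>\<^bsub>M\<^esub> m) = tensor (e j) (e j \<odot>\<^bsub>M\<^esub> m)"
proof -
  let ?t = "\<lambda>i. tensor (e i) (e i \<odot>\<^bsub>M\<^esub> m)"
  have delta: "(\<Oplus>\<^bsub>T\<^esub>i\<in>E. if j = i then ?t i else \<zero>\<^bsub>T\<^esub>) = ?t j"
    using j m finite_E by (intro T.finsum_singleton) auto
  have "e j \<odot>\<^bsub>T\<^esub> \<sigma> m = (\<Oplus>\<^bsub>T\<^esub>i\<in>E. if j = i then ?t i else \<zero>\<^bsub>T\<^esub>)"
    unfolding smult_sigma[OF e_closed[OF j] m] using j m
    by (intro T.finsum_cong' refl) (auto simp: e_mult)
  then show "e j \<odot>\<^bsub>T\<^esub> \<sigma> m = ?t j" using delta by simp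
  have "\<sigma> (e j \<odot>\<^bsub>M\<^esub> m) = (\<Oplus>\<^bsub>T\<^esub>i\<in>E. if j = i then ?t i else \<zero>\<^bsub>T\<^esub>)"
    unfolding section_map_def using j m
    by (intro T.finsum_cong' refl) (auto simp: e_smult)
  then show "\<sigma> (e j \<odot>\<^bsub>M\<^esub> m) = ?t j" using delta by simp
qed

lemma e_linear: "j \<in> E \<Longrightarrow> e j \<in> linear_scalars"
  by (simp add: linear_scalars_def e_smult_sigma sigma_e_smult)

text \<open>Such a c moves across each summand: \<open>c e\<^sub>i \<otimes> e\<^sub>i m = e\<^sub>i
  c \<otimes> e\<^sub>i m = e\<^sub>i \<otimes> c e\<^sub>i m = e\<^sub>i \<otimes> e\<^sub>i c
  m\<close>. This covers the scalars and the sums of vertices.\<close>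

lemma central_linear:
  assumes c: "c \<in> B" and central: "\<And>i. i \<in> E \<Longrightarrow> c \<otimes> e i = e i \<otimes> c"
  shows "c \<in> linear_scalars"
proof -
  have c_closed: "c \<in> carrier A" using c by (rule B_closed)
  have "tensor (c \<otimes> e i) (e i \<odot>\<^bsub>M\<^esub> m) = tensor (e i) (e i \<odot>\<^bsub>M\<^esub> (c \<odot>\<^bsub>M\<^esub> m))"
    if "i \<in> E" "m \<in> carrier M" for i m
    using that c c_closed tensor_balanced[of "e i" c "e i \<odot>\<^bsub>M\<^esub> m"]
    by (simp add: central M.smult_assoc[symmetric])
  then have "\<sigma> (c \<odot>\<^bsub>M\<^esub> m) = c \<odot>\<^bsub>T\<^esub> \<sigma> m" if "m \<in> carrier M" for m
    unfolding smult_sigma[OF c_closed that] section_map_def[of "c \<odot>\<^bsub>M\<^esub> m"] using that c_closed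
    by (intro T.finsum_cong' refl) auto
  then show ?thesis using c_closed by (simp add: linear_scalars_def)
qed

text \<open>
  Both \<open>b \<sigma>(m)\<close> and \<open>\<sigma>(b m)\<close> are the sum of all \<open>e\<^sub>h b e\<^sub>j \<otimes> e\<^sub>j m = e\<^sub>h \<otimes> e\<^sub>h b e\<^sub>j m\<close>. These two tensors
  agree since \<open>e\<^sub>h b e\<^sub>j \<noteq> 0\<close> forces \<open>e\<^sub>h b = e\<^sub>h b e\<^sub>j = b e\<^sub>j\<close>, so that \<open>b\<close> can be moved across.
\<close>

lemma monomial_linear:
  assumes b: "b \<in> B"
    and mono_right: "\<And>j. j \<in> E \<Longrightarrow> \<exists>h\<in>E. b \<otimes> e j = e h \<otimes> b \<otimes> e j"
    and mono_left: "\<And>h. h \<in> E \<Longrightarrow> \<exists>j\<in>E. e h \<otimes> b = e h \<otimes> b \<otimes> e j"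
  shows "b \<in> linear_scalars"
proof -
  have b_closed [simp]: "b \<in> carrier A" using b by (rule B_closed)
  have move: "tensor (e h \<otimes> b \<otimes> e j) (e j \<odot>\<^bsub>M\<^esub> m) = tensor (e h) (e h \<otimes> b \<otimes> e j \<odot>\<^bsub>M\<^esub> m)"
    if h: "h \<in> E" and j: "j \<in> E" and m: "m \<in> carrier M" for h j m
  proof (cases "e h \<otimes> b \<otimes> e j = \<zero>")
    case True
    then show ?thesis using h j m by simp
  next
    case False
    obtain h' where h': "h' \<in> E" "b \<otimes> e j = e h' \<otimes> b \<otimes> e j" using mono_right j by blast
    have "e h \<otimes> b \<otimes> e j = e h \<otimes> e h' \<otimes> (b \<otimes> e j)"
      using h j h' by (simp add: A.m_assoc)
    with False have "h' = h" using h j h'(1) by (auto simp: e_mult split: if_splits)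
    then have be: "b \<otimes> e j = e h \<otimes> b \<otimes> e j" using h' by simp
    obtain j' where j': "j' \<in> E" "e h \<otimes> b = e h \<otimes> b \<otimes> e j'" using mono_left h by blast
    have "e h \<otimes> b \<otimes> e j = e h \<otimes> b \<otimes> (e j' \<otimes> e j)"
      using h j j' by (metis A.m_assoc A.m_closed b_closed e_closed)
    with False have "j' = j" using h j j'(1) by (auto simp: e_mult split: if_splits)
    then have eb: "e h \<otimes> b \<otimes> e j = e h \<otimes> b" using j' by simp
    have "tensor (e h \<otimes> b \<otimes> e j) (e j \<odot>\<^bsub>M\<^esub> m) = tensor (e h) (b \<odot>\<^bsub>M\<^esub> (e j \<odot>\<^bsub>M\<^esub> m))"
      unfolding eb using h j m b by (intro tensor_balanced) auto
    also have "b \<odot>\<^bsub>M\<^esub> (e j \<odot>\<^bsub>M\<^esub> m) = e h \<otimes> b \<otimes> e j \<odot>\<^bsub>M\<^esub> m"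
      using j m be by (simp add: M.smult_assoc[symmetric])
    finally show ?thesis .
  qed
  have "\<sigma> (b \<odot>\<^bsub>M\<^esub> m) = b \<odot>\<^bsub>T\<^esub> \<sigma> m" if m: "m \<in> carrier M" for m
  proof -
    have "e h \<odot>\<^bsub>T\<^esub> (b \<odot>\<^bsub>T\<^esub> \<sigma> m) = tensor (e h) (e h \<odot>\<^bsub>M\<^esub> (b \<odot>\<^bsub>M\<^esub> m))" if h: "h \<in> E" for h
    proof -
      have "e h \<odot>\<^bsub>T\<^esub> (b \<odot>\<^bsub>T\<^esub> \<sigma> m) = (e h \<otimes> b) \<odot>\<^bsub>T\<^esub> \<sigma> m"
        using h m by (simp add: T.smult_assoc)
      also have "\<dots> = (\<Oplus>\<^bsub>T\<^esub>j\<in>E. tensor (e h \<otimes> b \<otimes> e j) (e j \<odot>\<^bsub>M\<^esub> m))"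
        using h m by (intro smult_sigma) auto
      also have "\<dots> = (\<Oplus>\<^bsub>T\<^esub>j\<in>E. tensor (e h) (e h \<otimes> b \<odot>\<^bsub>M\<^esub> (e j \<odot>\<^bsub>M\<^esub> m)))"
        using h m by (intro T.finsum_cong' refl) (auto simp: move M.smult_assoc)
      also have "\<dots> = tensor (e h) (\<Oplus>\<^bsub>M\<^esub>j\<in>E. e h \<otimes> b \<odot>\<^bsub>M\<^esub> (e j \<odot>\<^bsub>M\<^esub> m))"
        using h m by (intro tensor_finsum_right[symmetric]) auto
      also have "(\<Oplus>\<^bsub>M\<^esub>j\<in>E. e h \<otimes> b \<odot>\<^bsub>M\<^esub> (e j \<odot>\<^bsub>M\<^esub> m)) = e h \<otimes> b \<odot>\<^bsub>M\<^esub> (\<Oplus>\<^bsub>M\<^esub>j\<in>E. e j \<odot>\<^bsub>M\<^esub> m)"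
        using h m by (intro M.smult_finsum[symmetric]) auto
      also have "\<dots> = e h \<odot>\<^bsub>M\<^esub> (b \<odot>\<^bsub>M\<^esub> m)"
        using h m by (simp add: sum_e_smult M.smult_assoc)
      finally show ?thesis .
    qed
    then have "\<sigma> (b \<odot>\<^bsub>M\<^esub> m) = (\<Oplus>\<^bsub>T\<^esub>h\<in>E. e h \<odot>\<^bsub>T\<^esub> (b \<odot>\<^bsub>T\<^esub> \<sigma> m))"
      unfolding section_map_def[of "b \<odot>\<^bsub>M\<^esub> m"] using m by (intro T.finsum_cong' refl) auto
    then show ?thesis using m by (simp add: sum_e_smult_T)
  qed
  then show ?thesis by (simp add: linear_scalars_def)
qed

text \<open>The counit of the adjunction between induction and restriction. \<open>SOME\<close>
  names a map whose existence \<open>tensor_lift\<close> provides; the values on elementary tensors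
  determine it on the tensor product.\<close>

definition counit :: "('a \<times> 'm \<Rightarrow>\<^sub>0 int) set \<Rightarrow> 'm" (\<open>\<mu>\<close>) where
  "\<mu> = (SOME h. h \<in> left_module_hom A T M \<and>
     (\<forall>a\<in>carrier A. \<forall>m\<in>carrier M. h (tensor a m) = a \<odot>\<^bsub>M\<^esub> m))"

lemma
  shows mu_hom: "\<mu> \<in> left_module_hom A T M"
    and mu_tensor: "\<lbrakk>a \<in> carrier A; m \<in> carrier M\<rbrakk> \<Longrightarrow> \<mu> (tensor a m) = a \<odot>\<^bsub>M\<^esub> m"
proof -
  have "(\<lambda>m. m) \<in> left_module_hom (A\<lparr>carrier := B\<rparr>) M M"
    by (auto simp: left_module_hom_def)
  from tensor_lift[OF M.left_module_axioms this]
  have "\<exists>h. h \<in> left_module_hom A T M \<and>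
      (\<forall>a\<in>carrier A. \<forall>m\<in>carrier M. h (tensor a m) = a \<odot>\<^bsub>M\<^esub> m)"
    by metis
  from someI_ex[OF this]
  show "\<mu> \<in> left_module_hom A T M"
    "\<lbrakk>a \<in> carrier A; m \<in> carrier M\<rbrakk> \<Longrightarrow> \<mu> (tensor a m) = a \<odot>\<^bsub>M\<^esub> m"
    unfolding counit_def by blast+
qed

lemmas mu = left_module_homD[OF mu_hom]

lemma mu_sigma: "m \<in> carrier M \<Longrightarrow> \<mu> (\<sigma> m) = m"
proof -
  assume m: "m \<in> carrier M"
  have "\<mu> (\<sigma> m) = (\<Oplus>\<^bsub>M\<^esub>i\<in>E. \<mu> (tensor (e i) (e i \<odot>\<^bsub>M\<^esub> m)))"
    unfolding section_map_def using m
    by (intro left_module_hom_finsum[OF mu_hom T.left_module_axioms M.left_module_axioms]) auto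
  also have "\<dots> = (\<Oplus>\<^bsub>M\<^esub>i\<in>E. e i \<odot>\<^bsub>M\<^esub> m)"
    using m by (intro M.finsum_cong' refl) (auto simp: mu_tensor e_smult)
  finally show ?thesis using m by (simp add: sum_e_smult)
qed

end

section \<open>The idempotent endomorphism of the tensor product and the relatively projective
  cover\<close>

locale split_tensor = idempotent_tensor A B M E e
  for A :: "('a, 'r) ring_scheme" (structure) and B and M :: "('a, 'm) module"
    and E :: "'i set" and e +
  assumes B_linear: "B \<subseteq> linear_scalars"
begin

lemma sigma_hom: "\<sigma> \<in> left_module_hom (A\<lparr>carrier := B\<rparr>) M T"
  using B_linear linear_scalarsD by (intro left_module_homI) (auto simp: sigma_add)

definition projector :: "('a \<times> 'm \<Rightarrow>\<^sub>0 int) set \<Rightarrow> ('a \<times> 'm \<Rightarrow>\<^sub>0 int) set" (\<open>\<pi>\<close>) where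
  "\<pi> = (SOME h. h \<in> left_module_hom A T T \<and>
     (\<forall>a\<in>carrier A. \<forall>m\<in>carrier M. h (tensor a m) = a \<odot>\<^bsub>T\<^esub> \<sigma> m))"

lemma
  shows pi_hom: "\<pi> \<in> left_module_hom A T T"
    and pi_tensor: "\<lbrakk>a \<in> carrier A; m \<in> carrier M\<rbrakk> \<Longrightarrow> \<pi> (tensor a m) = a \<odot>\<^bsub>T\<^esub> \<sigma> m"
proof -
  from tensor_lift[OF T.left_module_axioms sigma_hom]
  have "\<exists>h. h \<in> left_module_hom A T T \<and>
      (\<forall>a\<in>carrier A. \<forall>m\<in>carrier M. h (tensor a m) = a \<odot>\<^bsub>T\<^esub> \<sigma> m)"
    by metis
  from someI_ex[OF this]
  show "\<pi> \<in> left_module_hom A T T"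
    "\<lbrakk>a \<in> carrier A; m \<in> carrier M\<rbrakk> \<Longrightarrow> \<pi> (tensor a m) = a \<odot>\<^bsub>T\<^esub> \<sigma> m"
    unfolding projector_def by blast+
qed

lemmas pi = left_module_homD[OF pi_hom]

text \<open>Each summand of \<sigma>(m) is fixed: \<pi> sends
  \<open>e\<^sub>i \<otimes> e\<^sub>i m\<close> to \<open>e\<^sub>i \<sigma>(e\<^sub>i m)\<close>,
  which orthogonality reduces to the same tensor. Since \<pi>(a \<otimes> m) = a \<sigma>(m),
  idempotence of \<pi> follows by linearity.\<close>

lemma pi_sigma:
  assumes m: "m \<in> carrier M" shows "\<pi> (\<sigma> m) = \<sigma> m"
proof -
  have "\<pi> (\<sigma> m) = (\<Oplus>\<^bsub>T\<^esub>i\<in>E. \<pi> (tensor (e i) (e i \<odot>\<^bsub>M\<^esub> m)))"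
    unfolding section_map_def using m
    by (intro left_module_hom_finsum[OF pi_hom T.left_module_axioms T.left_module_axioms]) auto
  also have "\<dots> = (\<Oplus>\<^bsub>T\<^esub>i\<in>E. tensor (e i) (e i \<odot>\<^bsub>M\<^esub> m))"
    using m by (intro T.finsum_cong' refl) (auto simp: pi_tensor e_smult_sigma e_smult)
  finally show ?thesis by (simp add: section_map_def)
qed

lemma pi_idem: "x \<in> carrier T \<Longrightarrow> \<pi> (\<pi> x) = \<pi> x"
proof (induction rule: tensor_induct)
  case zero
  then show ?case
    using left_module_hom_zero[OF pi_hom T.left_module_axioms T.left_module_axioms] by simp
qed (simp_all add: pi pi_tensor pi_sigma)

text \<open>The assumption \<open>L\<close> says that \<sigma> becomes A-linear after multiplication
  by a. Then a \<pi>(x) depends on x only through \<mu>(x), so a annihilates every element of the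
  image of \<pi> on which \<mu> vanishes.\<close>

lemma smult_pi:
  assumes a: "a \<in> carrier A"
    and L: "\<And>b m. b \<in> carrier A \<Longrightarrow> m \<in> carrier M \<Longrightarrow>
      a \<odot>\<^bsub>T\<^esub> (b \<odot>\<^bsub>T\<^esub> \<sigma> m) = a \<odot>\<^bsub>T\<^esub> \<sigma> (b \<odot>\<^bsub>M\<^esub> m)"
    and x: "x \<in> carrier T"
  shows "a \<odot>\<^bsub>T\<^esub> \<pi> x = a \<odot>\<^bsub>T\<^esub> \<sigma> (\<mu> x)"
  using x
proof (induction rule: tensor_induct)
  case zero
  show ?case
    using a left_module_hom_zero[OF pi_hom T.left_module_axioms T.left_module_axioms]
      left_module_hom_zero[OF mu_hom T.left_module_axioms M.left_module_axioms] by simp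
next
  case (tensor b m)
  then show ?case by (simp add: pi_tensor mu_tensor L)
next
  case (add x y)
  then show ?case using a by (simp add: pi mu sigma_add T.smult_r_distr)
qed

text \<open>The last clause is stated for one scalar a at a time, because linearity of \<sigma>
  after multiplication by a will be available only for vertices of high level. It is what lets the
  kernel be killed by more vertices than \<open>M\<close>.\<close>

lemma rel_projective_cover:
  fixes \<phi> :: "('a \<times> 'm \<Rightarrow>\<^sub>0 int) set \<Rightarrow> 'm"
  assumes inj: "inj_on \<phi> (carrier T)"
  obtains P q where "rel_projective A B (P :: ('a, 'm) module)"
    "q \<in> left_module_hom A P M" "q ` carrier P = carrier M"
    "direct_summand (A\<lparr>carrier := B\<rparr>) P (a_kernel P M q)"
    "\<And>a x. \<lbrakk>a \<in> carrier A; x \<in> a_kernel P M q;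
        \<And>b m. b \<in> carrier A \<Longrightarrow> m \<in> carrier M \<Longrightarrow>
          a \<odot>\<^bsub>T\<^esub> (b \<odot>\<^bsub>T\<^esub> \<sigma> m) = a \<odot>\<^bsub>T\<^esub> \<sigma> (b \<odot>\<^bsub>M\<^esub> m)\<rbrakk>
      \<Longrightarrow> a \<odot>\<^bsub>P\<^esub> x = \<zero>\<^bsub>P\<^esub>"
proof -
  define P0 where "P0 = T\<lparr>carrier := \<pi> ` carrier T\<rparr>"
  have P0_sub: "carrier P0 \<subseteq> carrier T" using pi(1) by (auto simp: P0_def)
  have P0: "left_module A P0"
    unfolding P0_def
    by (intro T.submodule_is_left_module submodule_image[OF pi_hom] T.left_module_axioms)
  have pi_P0: "\<pi> x = x" if "x \<in> carrier P0" for x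
    using that pi_idem by (auto simp: P0_def)
  have pi_hom_P0: "\<pi> \<in> left_module_hom A T P0"
    using pi by (auto simp: left_module_hom_def P0_def)
  have incl_hom: "(\<lambda>x. x) \<in> left_module_hom A P0 T"
    using P0_sub by (auto simp: left_module_hom_def P0_def)
  have mu_hom_P0: "\<mu> \<in> left_module_hom A P0 M"
    using left_module_hom_compose[OF incl_hom mu_hom] by simp
  have sigma_P0: "\<sigma> m \<in> carrier P0" if "m \<in> carrier M" for m
    using that pi_sigma[OF that] by (auto simp: P0_def intro!: image_eqI[of _ _ "\<sigma> m"])
  have sigma_hom_P0: "\<sigma> \<in> left_module_hom (A\<lparr>carrier := B\<rparr>) M P0"
    using sigma_hom sigma_P0 by (auto simp: left_module_hom_def P0_def)
  define P where "P = transport_module \<phi> P0"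
  define \<psi> where "\<psi> = inv_into (carrier P0) \<phi>"
  have inj0: "inj_on \<phi> (carrier P0)" using inj P0_sub by (rule inj_on_subset)
  note P = left_module_transport[OF P0 inj0, folded P_def]
    and phi_hom = transport_hom[OF P0 inj0, folded P_def]
    and psi_hom = transport_inv_hom[OF P0 inj0, folded P_def \<psi>_def]
  have psi_phi: "\<psi> (\<phi> x) = x" if "x \<in> carrier P0" for x
    using that inj0 by (simp add: \<psi>_def)
  have carrier_P: "carrier P = \<phi> ` carrier P0" by (simp add: P_def transport_module_def Let_def)
  have phi_psi: "\<phi> (\<psi> x) = x" if "x \<in> carrier P" for x
    using that carrier_P psi_phi by auto
  define q where "q x = \<mu> (\<psi> x)" for x
  have q_hom: "q \<in> left_module_hom A P M"
    unfolding q_def using left_module_hom_compose[OF psi_hom mu_hom_P0] by simp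
  have s_hom: "(\<lambda>m. \<phi> (\<sigma> m)) \<in> left_module_hom (A\<lparr>carrier := B\<rparr>) M P"
    using left_module_hom_compose[OF sigma_hom_P0 left_module_hom_restrict_scalars[OF phi_hom B_subset]]
    by simp
  have q_s: "q (\<phi> (\<sigma> m)) = m" if "m \<in> carrier M" for m
    using that by (simp add: q_def psi_phi sigma_P0 mu_sigma)
  show thesis
  proof
    show "rel_projective A B P"
    proof (rule rel_projectiveI[OF P])
      show "\<psi> \<in> left_module_hom A P T"
        using left_module_hom_compose[OF psi_hom incl_hom] by simp
      show "(\<lambda>x. \<phi> (\<pi> x)) \<in> left_module_hom A T P"
        by (rule left_module_hom_compose[OF pi_hom_P0 phi_hom])
      show "\<phi> (\<pi> (\<psi> x)) = x" if "x \<in> carrier P" for x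
        using that left_module_homD(1)[OF psi_hom] by (simp add: pi_P0 phi_psi)
    qed
    show "q \<in> left_module_hom A P M" by (rule q_hom)
    show "q ` carrier P = carrier M"
      using left_module_homD(1)[OF q_hom] left_module_homD(1)[OF s_hom] q_s
      by (metis (no_types, lifting) image_subset_iff subsetI subset_antisym image_eqI)
    show "direct_summand (A\<lparr>carrier := B\<rparr>) P (a_kernel P M q)"
      using direct_summand_split(1)[OF left_module_hom_restrict_scalars[OF q_hom B_subset] s_hom
          left_module.restrict_scalars[OF P subring] M.restrict_scalars[OF subring] q_s] .
    show "a \<odot>\<^bsub>P\<^esub> x = \<zero>\<^bsub>P\<^esub>"
      if a: "a \<in> carrier A" and x: "x \<in> a_kernel P M q"
        and L: "\<And>b m. b \<in> carrier A \<Longrightarrow> m \<in> carrier M \<Longrightarrow>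
          a \<odot>\<^bsub>T\<^esub> (b \<odot>\<^bsub>T\<^esub> \<sigma> m) = a \<odot>\<^bsub>T\<^esub> \<sigma> (b \<odot>\<^bsub>M\<^esub> m)" for a x
    proof -
      have xP: "x \<in> carrier P" and "\<mu> (\<psi> x) = \<zero>\<^bsub>M\<^esub>"
        using x by (auto simp: mem_a_kernel_iff q_def)
      moreover have y: "\<psi> x \<in> carrier P0" using left_module_homD(1)[OF psi_hom xP] .
      \<comment> \<open>As \<psi> x lies in the image of \<pi>, it equals \<pi>(\<psi> x), and a
        \<pi>(\<psi> x) = a \<sigma>(\<mu>(\<psi> x)) = a \<sigma>(0) = 0.\<close>
      ultimately have "a \<odot>\<^bsub>T\<^esub> \<psi> x = \<zero>\<^bsub>T\<^esub>"
        using smult_pi[OF a L, of "\<psi> x"] a P0_sub pi_P0[OF y] by auto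
      then have "a \<odot>\<^bsub>P0\<^esub> \<psi> x = \<zero>\<^bsub>P0\<^esub>" by (simp add: P0_def)
      then show ?thesis
        using left_module_homD(3)[OF phi_hom a y] left_module_hom_zero[OF phi_hom P0 P] phi_psi[OF xP]
        by simp
    qed
  qed
qed

text \<open>The idempotents sum to one, so linearity of \<sigma> after multiplication by each of
  them is linearity of \<sigma> itself, and \<open>M\<close> becomes a retract of the tensor
  product. This is how a resolution terminates.\<close>

lemma rel_projective_self:
  assumes L: "\<And>i b m. \<lbrakk>i \<in> E; b \<in> carrier A; m \<in> carrier M\<rbrakk> \<Longrightarrow>
      e i \<odot>\<^bsub>T\<^esub> (b \<odot>\<^bsub>T\<^esub> \<sigma> m) = e i \<odot>\<^bsub>T\<^esub> \<sigma> (b \<odot>\<^bsub>M\<^esub> m)"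
  shows "rel_projective A B M"
proof (rule rel_projectiveI[OF M.left_module_axioms _ mu_hom mu_sigma])
  have "\<sigma> (b \<odot>\<^bsub>M\<^esub> m) = b \<odot>\<^bsub>T\<^esub> \<sigma> m" if "b \<in> carrier A" "m \<in> carrier M" for b m
  proof -
    have "\<sigma> (b \<odot>\<^bsub>M\<^esub> m) = (\<Oplus>\<^bsub>T\<^esub>i\<in>E. e i \<odot>\<^bsub>T\<^esub> \<sigma> (b \<odot>\<^bsub>M\<^esub> m))"
      using that by (simp add: sum_e_smult_T)
    also have "\<dots> = (\<Oplus>\<^bsub>T\<^esub>i\<in>E. e i \<odot>\<^bsub>T\<^esub> (b \<odot>\<^bsub>T\<^esub> \<sigma> m))"
      using that by (intro T.finsum_cong' refl) (auto simp: L)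
    also have "\<dots> = b \<odot>\<^bsub>T\<^esub> \<sigma> m" using that by (simp add: sum_e_smult_T)
    finally show ?thesis .
  qed
  then show "\<sigma> \<in> left_module_hom A M T"
    by (intro left_module_homI) (auto simp: sigma_add)
qed

end

section \<open>Relative resolutions\<close>

text \<open>The resolution is the identity map of \<open>M\<close>, continued by zero
  modules.\<close>

lemma has_rel_resolution_zero:
  fixes M :: "('a, 'm) module"
  assumes A: "ring A" and B: "subring B A" and M: "rel_projective A B M"
  shows "has_rel_resolution A B M 0"
proof -
  have lM: "left_module A M" using M by (simp add: rel_projective_def)
  interpret M: left_module A M by (rule lM)
  define Z where "Z = M\<lparr>carrier := {\<zero>\<^bsub>M\<^esub>}\<rparr>"
  have Z [simp]: "carrier Z = {\<zero>\<^bsub>M\<^esub>}" "\<zero>\<^bsub>Z\<^esub> = \<zero>\<^bsub>M\<^esub>" by (simp_all add: Z_def)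
  have lZ: "left_module A Z"
    unfolding Z_def by (intro M.submodule_is_left_module M.submoduleI) auto
  \<comment> \<open>Index 0 is the resolved module and index 1 its term in degree zero, so both are
    \<open>M\<close>. All later terms are the zero submodule of \<open>M\<close>, which shares the
    operations and the zero element of \<open>M\<close>.\<close>
  define X where "X i = (if i \<le> 1 then M else Z)" for i :: nat
  define d where "d i = (if i = 0 then (\<lambda>x. x) else (\<lambda>_. \<zero>\<^bsub>M\<^esub>))" for i :: nat
  have X [simp]: "X 0 = M" "X (Suc 0) = M" "X (Suc (Suc i)) = Z" for i by (simp_all add: X_def)
  have d [simp]: "d 0 = (\<lambda>x. x)" "d (Suc i) = (\<lambda>_. \<zero>\<^bsub>M\<^esub>)" for i by (simp_all add: d_def)
  have lX: "left_module A (X i)" for i by (simp add: X_def lM lZ)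
  have d_hom: "d i \<in> left_module_hom A (X (Suc i)) (X i)" for i
    by (cases i; cases "i - 1") (auto simp: left_module_hom_def Z_def)
  have kernel: "a_kernel (X (Suc i)) (X i) (d i) = {\<zero>\<^bsub>M\<^esub>}" for i
    by (cases i; cases "i - 1") (auto simp: mem_a_kernel_iff)
  \<comment> \<open>The zero submodule is the kernel of the identity of \<open>M\<close> and the
    image of the identity of \<open>Z\<close>, so both cases are instances of
    \<open>direct_summand_split\<close>.\<close>
  have summand: "direct_summand (A\<lparr>carrier := B\<rparr>) (X (Suc i)) {\<zero>\<^bsub>M\<^esub>}" for i
  proof (cases i)
    case 0
    have id: "(\<lambda>x. x) \<in> left_module_hom (A\<lparr>carrier := B\<rparr>) M M" by (auto simp: left_module_hom_def)
    show ?thesis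
      using direct_summand_split(1)[OF id id] M.restrict_scalars[OF B] kernel[of 0] 0 by simp
  next
    case (Suc i')
    have id: "(\<lambda>x. x) \<in> left_module_hom (A\<lparr>carrier := B\<rparr>) Z Z" by (auto simp: left_module_hom_def)
    show ?thesis
      using direct_summand_split(2)[OF id id] left_module.restrict_scalars[OF lZ B] Suc by simp
  qed
  have "rel_exact A B X d"
    unfolding rel_exact_def by (simp only: lX d_hom kernel summand) simp
  then show ?thesis
    unfolding has_rel_resolution_def using M by (intro exI[of _ X] exI[of _ d]) (auto simp: X_def)
qed

text \<open>Splicing at the kernel: the map from the first term of its resolution onto the kernel is
  followed by the inclusion into \<open>P\<close>.\<close>

lemma has_rel_resolution_Suc:
  fixes M P :: "('a, 'm) module"
  assumes M: "left_module A M" and P: "rel_projective A B P"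
    and q: "q \<in> left_module_hom A P M" "q ` carrier P = carrier M"
    and summand: "direct_summand (A\<lparr>carrier := B\<rparr>) P (a_kernel P M q)"
    and resolution: "has_rel_resolution A B (P\<lparr>carrier := a_kernel P M q\<rparr>) n"
  shows "has_rel_resolution A B M (Suc n)"
proof -
  let ?K = "a_kernel P M q"
  have lP: "left_module A P" using P by (simp add: rel_projective_def)
  obtain X d where Xd: "rel_exact A B X d" and X0: "X 0 = P\<lparr>carrier := ?K\<rparr>"
    and proj: "\<And>i. i \<le> n \<Longrightarrow> rel_projective A B (X (Suc i))"
    and triv: "\<And>i. i > n \<Longrightarrow> carrier (X (Suc i)) = {\<zero>\<^bsub>X (Suc i)\<^esub>}"
    using resolution unfolding has_rel_resolution_def by blast
  have lX: "\<And>i. left_module A (X i)"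
    and d_hom: "\<And>i. d i \<in> left_module_hom A (X (Suc i)) (X i)"
    and d0: "d 0 ` carrier (X 1) = carrier (X 0)"
    and d_image: "\<And>i. d (Suc i) ` carrier (X (Suc (Suc i))) = a_kernel (X (Suc i)) (X i) (d i)"
    and d_summand: "\<And>i. direct_summand (A\<lparr>carrier := B\<rparr>) (X (Suc i)) (a_kernel (X (Suc i)) (X i) (d i))"
    using Xd by (auto simp: rel_exact_def)
  \<comment> \<open>The kernel \<open>X 0\<close> leaves the sequence and \<open>M\<close>,
    \<open>P\<close> take the first two places, so the terms \<open>X 1\<close>, \<open>X 2\<close>,
    ... move up by one index.\<close>
  define Y where "Y i = (if i = 0 then M else if i = 1 then P else X (i - 1))" for i
  define c where "c i = (if i = 0 then q else d (i - 1))" for i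
  have Y [simp]: "Y 0 = M" "Y (Suc 0) = P" "Y (Suc (Suc i)) = X (Suc i)" for i by (simp_all add: Y_def)
  have c [simp]: "c 0 = q" "c (Suc i) = d i" for i by (simp_all add: c_def)
  have K_sub: "?K \<subseteq> carrier P" by (auto simp: mem_a_kernel_iff)
  \<comment> \<open>The kernel has the operations and the zero of \<open>P\<close> on a smaller
    carrier, so the function \<open>d 0\<close> can be read as a map into \<open>P\<close> without
    change, and its own kernel stays the same.\<close>
  have d0_hom: "d 0 \<in> left_module_hom A (X (Suc 0)) P"
    using d_hom[of 0] K_sub unfolding X0 by (auto simp: left_module_hom_def)
  have d0_kernel: "a_kernel (X (Suc 0)) P (d 0) = a_kernel (X (Suc 0)) (X 0) (d 0)"
    by (auto simp: mem_a_kernel_iff X0)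
  have "rel_exact A B Y c"
    unfolding rel_exact_def
  proof (intro conjI allI)
    show "left_module A (Y i)" for i by (simp add: Y_def M lP lX)
    show "c i \<in> left_module_hom A (Y (Suc i)) (Y i)" for i
      using q(1) d0_hom d_hom by (cases i; cases "i - 1") simp_all
    show "c 0 ` carrier (Y 1) = carrier (Y 0)" by (simp add: q)
    show "c (Suc i) ` carrier (Y (Suc (Suc i))) = a_kernel (Y (Suc i)) (Y i) (c i)" for i
      using d0 d_image by (cases i; cases "i - 1") (simp_all add: X0 d0_kernel)
    show "direct_summand (A\<lparr>carrier := B\<rparr>) (Y (Suc i)) (a_kernel (Y (Suc i)) (Y i) (c i))" for i
      using summand d_summand by (cases i; cases "i - 1") (simp_all add: d0_kernel)
  qed
  moreover have "rel_projective A B (Y (Suc i))" if "i \<le> Suc n" for i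
    using that P proj by (cases i) simp_all
  moreover have "carrier (Y (Suc i)) = {\<zero>\<^bsub>Y (Suc i)\<^esub>}" if "i > Suc n" for i
    using that triv by (cases i) simp_all
  ultimately show ?thesis
    unfolding has_rel_resolution_def by (intro exI[of _ Y] exI[of _ c]) simp
qed

lemma rel_gldim_leI:
  assumes "\<And>M :: ('a, 'm) module. left_module A M \<Longrightarrow> has_rel_resolution A B M n"
  shows "rel_gldim TYPE('m) A B \<le> enat n"
  unfolding rel_gldim_def
proof (rule Sup_least)
  fix x assume "x \<in> {rel_pd A B M |M :: ('a, 'm) module. left_module A M}"
  then obtain M :: "('a, 'm) module" where M: "left_module A M" "x = rel_pd A B M" by blast
  then show "x \<le> enat n"
    unfolding rel_pd_def using assms by (auto intro!: Inf_lower)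
qed

section \<open>Generated subalgebras and the size of a tensor product\<close>

lemma generated_subalgebra_least:
  assumes "subring D A" "K \<subseteq> D" "S \<subseteq> D"
  shows "generated_subalgebra K A S \<subseteq> D"
proof -
  have "subalgebra K D A"
    using assms subring.axioms(1)[OF assms(1)] subringE(6)[OF assms(1)]
    by (intro subalgebra.intro subalgebra_axioms.intro) auto
  then show ?thesis using assms by (auto simp: generated_subalgebra_def)
qed

text \<open>The whole ring belongs to the family that is intersected, so the intersection lies
  inside it. \<open>K\<close> is contained in each member because k = k 1.\<close>

lemma (in ring) generated_subalgebra:
  assumes K: "K \<subseteq> carrier R" and S: "S \<subseteq> carrier R"
  shows subring_generated_subalgebra: "subring (generated_subalgebra K R S) R"
    and generated_subalgebra_scalars: "K \<subseteq> generated_subalgebra K R S"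
    and generated_subalgebra_generators: "S \<subseteq> generated_subalgebra K R S"
proof -
  let ?G = "{C. subring C R \<and> subalgebra K C R \<and> S \<subseteq> C}"
  have carrier: "carrier R \<in> ?G"
    using S carrier_is_subring carrier_is_subalgebra[OF K] by blast
  show "subring (generated_subalgebra K R S) R"
    unfolding generated_subalgebra_def using carrier
    by (intro subringI) (auto intro: subringE)
  show "K \<subseteq> generated_subalgebra K R S"
  proof
    fix k assume k: "k \<in> K"
    have "k \<in> C" if "subring C R" "subalgebra K C R" for C
      using subalgebra.smult_closed[OF that(2) k, of \<one>] subringE(3)[OF that(1)] k K by auto
    then show "k \<in> generated_subalgebra K R S" by (auto simp: generated_subalgebra_def)
  qed
  show "S \<subseteq> generated_subalgebra K R S" by (auto simp: generated_subalgebra_def)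
qed

text \<open>The tensor product is an image of a free abelian group, which over an infinite set has
  the size of that set; and the square of an infinite set is no larger than the set.\<close>

lemma (in tensor) lepoll_tensor_product_universe:
  assumes "carrier A \<lesssim> carrier V" "infinite (carrier V)"
  shows "carrier T \<lesssim> carrier V"
proof -
  have "carrier A \<noteq> {}" "carrier V \<noteq> {}" using A.zero_closed V.M.zero_closed by blast+
  then have inf: "infinite (carrier A \<times> carrier V)"
    using assms(2) by (simp add: finite_cartesian_product_iff)
  have "carrier T \<lesssim> carrier F" by (rule lepoll_tensor_product)
  also have "\<dots> \<approx> carrier A \<times> carrier V" by (rule eqpoll_free_Abelian_group_infinite[OF inf])
  also have "\<dots> \<lesssim> carrier V \<times> carrier V" by (rule times_lepoll_mono[OF assms(1) lepoll_refl])
  also have "\<dots> \<approx> carrier V"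
    using card_of_Times_same_infinite[OF assms(2)] by (simp add: eqpoll_iff_card_of_ordIso)
  finally show ?thesis .
qed

section \<open>Quotients of path algebras\<close>

text \<open>Over a finite field the product of all X - a, plus one, would be a polynomial of
  positive degree without a root.\<close>

lemma infinite_UNIV_alg_closed_field: "infinite (UNIV :: 'k::alg_closed_field set)"
proof
  assume fin: "finite (UNIV :: 'k set)"
  define p :: "'k poly" where "p = (\<Prod>a\<in>UNIV. [:- a, 1:])"
  have deg: "degree p = card (UNIV :: 'k set)"
    unfolding p_def by (subst degree_prod_eq_sum_degree) auto
  then have "degree p > 0" using fin by (simp add: card_gt_0_iff)
  then have "degree (p + 1) > 0" by (subst degree_add_eq_left) auto
  then obtain x where "poly (p + 1) x = 0" using alg_closed_imp_poly_has_root by blast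
  moreover have "poly p x = 0" using fin by (simp add: p_def poly_prod)
  ultimately show False by simp
qed

lemma carrier_FactRing: "carrier (R Quot I) = (\<Union>x\<in>carrier R. {I +>\<^bsub>R\<^esub> x})"
  by (simp add: FactRing_def A_RCOSETS_def')

locale quiver_quotient = fin_digraph Q + I: ideal I "path_algebra Q"
  for Q :: "('v, 'e) pre_digraph" and I :: "('v \<times> 'e list \<Rightarrow> 'k::field) set"
begin

abbreviation kQ :: "('v \<times> 'e list \<Rightarrow> 'k) ring" where "kQ \<equiv> path_algebra Q"
abbreviation A :: "('v \<times> 'e list \<Rightarrow> 'k) set ring" where "A \<equiv> quiver_algebra Q I"
abbreviation path :: "'v \<Rightarrow> 'e list \<Rightarrow> ('v \<times> 'e list \<Rightarrow> 'k) set" where "path u p \<equiv> path_elem Q I (u, p)"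
abbreviation vertex :: "'v \<Rightarrow> ('v \<times> 'e list \<Rightarrow> 'k) set" where "vertex \<equiv> vertex_elem Q I"
abbreviation arrow :: "'e \<Rightarrow> ('v \<times> 'e list \<Rightarrow> 'k) set" where "arrow \<equiv> arrow_elem Q I"
abbreviation scalar :: "'k \<Rightarrow> ('v \<times> 'e list \<Rightarrow> 'k) set" where "scalar \<equiv> scalar_elem Q I"

text \<open>The representative inside \<open>scalar_elem\<close>. Scalars are handled as ring
  elements, since the modules get their vector space structure only through the unit of the
  ring.\<close>

definition const :: "'k \<Rightarrow> 'v \<times> 'e list \<Rightarrow> 'k" where
  "const c = (\<lambda>p. c * \<one>\<^bsub>kQ\<^esub> p)"

sublocale A: ring A
  by (rule I.quotient_is_ring)

sublocale quot: ring_hom_ring kQ A "(+>\<^bsub>kQ\<^esub>) I"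
  by (rule I.rcos_ring_hom_ring)

lemma carrier_kQ: "f \<in> carrier kQ \<longleftrightarrow> finite {p. f p \<noteq> 0} \<and> {p. f p \<noteq> 0} \<subseteq> paths Q"
  by (simp add: path_algebra_def)

lemma mult_kQ: "(f \<otimes>\<^bsub>kQ\<^esub> g) (u, p) = (\<Sum>i\<le>length p. f (awlast u (take i p), drop i p) * g (u, take i p))"
  by (simp add: path_algebra_def)

lemma one_kQ: "\<one>\<^bsub>kQ\<^esub> (u, p) = (if u \<in> verts Q \<and> p = [] then 1 else 0)"
  by (simp add: path_algebra_def)

lemma add_kQ: "f \<oplus>\<^bsub>kQ\<^esub> g = (\<lambda>p. f p + g p)"
  by (simp add: path_algebra_def)

lemma zero_kQ: "\<zero>\<^bsub>kQ\<^esub> = (\<lambda>_. 0)"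
  by (simp add: path_algebra_def)

lemma paths_iff: "(u, p) \<in> paths Q \<longleftrightarrow> awalk u p (awlast u p)"
  unfolding paths_def using awalk_ends by (auto simp: awalk_def)

lemma vertex_path: "v \<in> verts Q \<Longrightarrow> (v, []) \<in> paths Q"
  by (simp add: paths_iff awalk_Nil_iff)

lemma single_closed: "p \<in> paths Q \<Longrightarrow> single_path p \<in> carrier kQ"
  by (auto simp: carrier_kQ single_path_def)

lemma const_closed: "const c \<in> carrier kQ"
proof -
  have "{p. const c p \<noteq> 0} \<subseteq> (\<lambda>v. (v, [])) ` verts Q"
    by (auto simp: const_def one_kQ split: if_splits)
  moreover have "(\<lambda>v. (v, [])) ` verts Q \<subseteq> paths Q"
    using vertex_path by auto
  ultimately show ?thesis
    unfolding carrier_kQ using finite_verts finite_subset by blast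
qed

text \<open>Only the cut with empty last part meets the support of \<open>const c\<close>. The
  coefficient there is c because a path in the support of f ends at a vertex of \<open>Q\<close>;
  off this support both sides vanish.\<close>

lemma const_mult:
  assumes f: "f \<in> carrier kQ" shows "const c \<otimes>\<^bsub>kQ\<^esub> f = (\<lambda>p. c * f p)"
proof (rule ext, clarify)
  fix u p
  have "(const c \<otimes>\<^bsub>kQ\<^esub> f) (u, p) =
      (\<Sum>i\<le>length p. if i = length p then const c (awlast u p, []) * f (u, p) else 0)"
    unfolding mult_kQ by (intro sum.cong refl) (auto simp: const_def one_kQ)
  also have "\<dots> = const c (awlast u p, []) * f (u, p)"
    by simp
  also have "\<dots> = c * f (u, p)"
  proof (cases "f (u, p) = 0")
    case False
    then have "awlast u p \<in> verts Q"
      using f paths_iff[of u p] awalk_last_in_verts by (auto simp: carrier_kQ)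
    then show ?thesis by (simp add: const_def one_kQ)
  qed simp
  finally show "(const c \<otimes>\<^bsub>kQ\<^esub> f) (u, p) = c * f (u, p)" .
qed

lemma mult_const:
  assumes f: "f \<in> carrier kQ" shows "f \<otimes>\<^bsub>kQ\<^esub> const c = (\<lambda>p. c * f p)"
proof (rule ext, clarify)
  fix u p
  have "(f \<otimes>\<^bsub>kQ\<^esub> const c) (u, p) =
      (\<Sum>i\<le>length p. if i = 0 then f (u, p) * const c (u, []) else 0)"
    unfolding mult_kQ by (intro sum.cong refl) (auto simp: const_def one_kQ)
  also have "\<dots> = f (u, p) * const c (u, [])"
    by simp
  also have "\<dots> = c * f (u, p)"
  proof (cases "f (u, p) = 0")
    case False
    then have "u \<in> verts Q"
      using f paths_iff[of u p] by (auto simp: carrier_kQ awalk_def)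
    then show ?thesis by (simp add: const_def one_kQ)
  qed simp
  finally show "(f \<otimes>\<^bsub>kQ\<^esub> const c) (u, p) = c * f (u, p)" .
qed

text \<open>A cut of r into p and q exists only if r = p @ q, and then only at position
  \<open>length p\<close>. The right factor is traversed first, whence the order in
  \<open>p @ q\<close>.\<close>

lemma single_mult:
  "single_path (v, q) \<otimes>\<^bsub>kQ\<^esub> single_path (u, p) =
    (if awlast u p = v then single_path (u, p @ q) else \<zero>\<^bsub>kQ\<^esub>)"
proof (rule ext, clarify)
  fix w r
  have "(single_path (v, q) \<otimes>\<^bsub>kQ\<^esub> single_path (u, p)) (w, r) =
      (\<Sum>i\<le>length r. if i = length p then (if awlast u p = v \<and> w = u \<and> r = p @ q then 1 else 0) else (0 :: 'k))"
    unfolding mult_kQ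
  proof (intro sum.cong refl)
    fix i assume "i \<in> {..length r}"
    then have cut: "take i r = p \<and> drop i r = q \<longleftrightarrow> i = length p \<and> r = p @ q"
      by (metis append_eq_conv_conj append_take_drop_id atMost_iff length_take min.absorb2)
    have "single_path (v, q) (awlast w (take i r), drop i r) * single_path (u, p) (w, take i r) =
        (if awlast u p = v \<and> w = u \<and> take i r = p \<and> drop i r = q then 1 else (0 :: 'k))"
      by (simp add: single_path_def)
    also have "\<dots> = (if i = length p then (if awlast u p = v \<and> w = u \<and> r = p @ q then 1 else 0) else 0)"
      unfolding cut by simp
    finally show "single_path (v, q) (awlast w (take i r), drop i r) * single_path (u, p) (w, take i r) =
        (if i = length p then (if awlast u p = v \<and> w = u \<and> r = p @ q then 1 else 0) else (0 :: 'k))" .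
  qed
  also have "\<dots> = (if awlast u p = v \<and> w = u \<and> r = p @ q then 1 else 0)"
    by (auto simp: sum.delta)
  also have "\<dots> = (if awlast u p = v then single_path (u, p @ q) else \<zero>\<^bsub>kQ\<^esub>) (w, r)"
    by (auto simp: single_path_def zero_kQ)
  finally show "(single_path (v, q) \<otimes>\<^bsub>kQ\<^esub> single_path (u, p)) (w, r) =
      (if awlast u p = v then single_path (u, p @ q) else \<zero>\<^bsub>kQ\<^esub>) (w, r)" .
qed

lemma path_closed [simp]: "p \<in> paths Q \<Longrightarrow> path_elem Q I p \<in> carrier A"
  by (simp add: path_elem_def single_closed)

lemma vertex_closed [simp]: "v \<in> verts Q \<Longrightarrow> vertex v \<in> carrier A"
  by (simp add: vertex_path)

lemma scalar_closed [simp]: "scalar c \<in> carrier A"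
  using quot.hom_closed[OF const_closed[of c]] by (simp add: scalar_elem_def const_def)

lemma arrow_path: "a \<in> arcs Q \<Longrightarrow> (tail Q a, [a]) \<in> paths Q"
  by (simp add: paths_iff awalk_simps)

lemma path_mult:
  assumes "(v, q) \<in> paths Q" "(u, p) \<in> paths Q"
  shows "path v q \<otimes>\<^bsub>A\<^esub> path u p = (if awlast u p = v then path u (p @ q) else \<zero>\<^bsub>A\<^esub>)"
  using assms quot.hom_mult[OF single_closed single_closed, of "(v, q)" "(u, p)"]
  by (cases "awlast u p = v") (simp_all add: path_elem_def single_mult)

lemma A_cases:
  assumes "a \<in> carrier A"
  obtains f where "f \<in> carrier kQ" "a = I +>\<^bsub>kQ\<^esub> f"
  using assms that unfolding carrier_FactRing by blast

lemma scalar_const: "scalar c = I +>\<^bsub>kQ\<^esub> const c"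
  by (simp add: scalar_elem_def const_def)

lemma scalar_mult_commute:
  assumes "a \<in> carrier A" shows "scalar c \<otimes>\<^bsub>A\<^esub> a = a \<otimes>\<^bsub>A\<^esub> scalar c"
proof -
  obtain f where f: "f \<in> carrier kQ" "a = I +>\<^bsub>kQ\<^esub> f"
    using assms by (rule A_cases)
  have "const c \<otimes>\<^bsub>kQ\<^esub> f = f \<otimes>\<^bsub>kQ\<^esub> const c"
    by (simp only: const_mult mult_const f)
  then show ?thesis
    unfolding f(2) scalar_const
    by (metis quot.hom_mult const_closed f(1))
qed

lemma scalar_diff: "scalar c \<ominus>\<^bsub>A\<^esub> scalar d = scalar (c - d)"
proof -
  have "const (c - d) \<oplus>\<^bsub>kQ\<^esub> const d = const c"
    by (rule ext) (simp add: const_def add_kQ algebra_simps)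
  then have *: "scalar c = scalar (c - d) \<oplus>\<^bsub>A\<^esub> scalar d"
    using quot.hom_add[OF const_closed const_closed, of "c - d" d] by (simp add: scalar_const)
  show ?thesis
    by (subst *) (simp add: A.minus_eq A.a_assoc A.r_neg)
qed

lemma scalar_inverse: "c \<noteq> 0 \<Longrightarrow> scalar (inverse c) \<otimes>\<^bsub>A\<^esub> scalar c = \<one>\<^bsub>A\<^esub>"
proof -
  assume "c \<noteq> 0"
  then have "const (inverse c) \<otimes>\<^bsub>kQ\<^esub> const c = \<one>\<^bsub>kQ\<^esub>"
    unfolding const_mult[OF const_closed] by (simp add: const_def fun_eq_iff)
  then show ?thesis
    using quot.hom_mult[OF const_closed const_closed, of "inverse c" c]
    by (simp add: scalar_const)
qed

lemma vertex_mult: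
  assumes "v \<in> verts Q" "w \<in> verts Q"
  shows "vertex v \<otimes>\<^bsub>A\<^esub> vertex w = (if v = w then vertex v else \<zero>\<^bsub>A\<^esub>)"
  using path_mult[of v "[]" w "[]"] assms by (auto simp: vertex_path)

lemma vertex_sum: "(\<Oplus>\<^bsub>A\<^esub>v\<in>verts Q. vertex v) = \<one>\<^bsub>A\<^esub>"
proof -
  \<comment> \<open>Generalised to sets of vertices so that \<open>finite_induct\<close> applies.
    Membership in \<open>kQ\<close> is carried along because the quotient map is known to be
    additive only there.\<close>
  have "(\<Oplus>\<^bsub>A\<^esub>v\<in>S. vertex v) = I +>\<^bsub>kQ\<^esub> (\<lambda>(u, p). if u \<in> S \<and> p = [] then 1 else 0) \<and>
      (\<lambda>(u, p). if u \<in> S \<and> p = [] then 1 else 0) \<in> carrier kQ"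
    if "finite S" "S \<subseteq> verts Q" for S
    using that
  proof (induction S rule: finite_induct)
    case empty
    have "(\<lambda>(u, p). if u \<in> {} \<and> p = [] then 1 else 0) = \<zero>\<^bsub>kQ\<^esub>" by (auto simp: zero_kQ)
    then show ?case using quot.hom_zero I.zero_closed by simp
  next
    case (insert v S)
    let ?f = "\<lambda>S (u, p). if u \<in> S \<and> p = [] then 1 else 0 :: 'k"
    have IH: "(\<Oplus>\<^bsub>A\<^esub>v\<in>S. vertex v) = I +>\<^bsub>kQ\<^esub> ?f S" "?f S \<in> carrier kQ"
      using insert by auto
    have v: "single_path (v, []) \<in> carrier kQ"
      using insert by (simp add: single_closed vertex_path)
    have sum: "?f (insert v S) = single_path (v, []) \<oplus>\<^bsub>kQ\<^esub> ?f S"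
      using insert(2) by (auto simp: add_kQ single_path_def fun_eq_iff)
    have "(\<Oplus>\<^bsub>A\<^esub>v\<in>insert v S. vertex v) = vertex v \<oplus>\<^bsub>A\<^esub> (\<Oplus>\<^bsub>A\<^esub>v\<in>S. vertex v)"
      using insert by (intro A.finsum_insert) auto
    also have "\<dots> = I +>\<^bsub>kQ\<^esub> ?f (insert v S)"
      unfolding IH(1) sum using quot.hom_add[OF v IH(2)] by (simp add: path_elem_def)
    finally show ?case
      using sum v IH(2) by (metis I.add.m_closed)
  qed
  from this[of "verts Q"] have "(\<Oplus>\<^bsub>A\<^esub>v\<in>verts Q. vertex v) =
      I +>\<^bsub>kQ\<^esub> (\<lambda>(u, p). if u \<in> verts Q \<and> p = [] then 1 else 0)"
    by simp
  also have "(\<lambda>(u, p). if u \<in> verts Q \<and> p = [] then 1 else 0) = \<one>\<^bsub>kQ\<^esub>"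
    by (auto simp: one_kQ)
  finally show ?thesis using quot.hom_one by simp
qed

text \<open>Every class is a finite sum of paths times scalars. The scalar stands to the right of
  the path, so that in a module it can be absorbed into the vector acted on, leaving a bare
  path.\<close>

lemma A_induct [consumes 1, case_names zero path add]:
  assumes a: "a \<in> carrier A"
    and zero: "P \<zero>\<^bsub>A\<^esub>"
    and path: "\<And>c p. p \<in> paths Q \<Longrightarrow> P (path_elem Q I p \<otimes>\<^bsub>A\<^esub> scalar c)"
    and add: "\<And>a b. a \<in> carrier A \<Longrightarrow> b \<in> carrier A \<Longrightarrow> P a \<Longrightarrow> P b \<Longrightarrow> P (a \<oplus>\<^bsub>A\<^esub> b)"
  shows "P a"
proof -
  \<comment> \<open>The induction runs over a finite set containing the support rather than over the
    support itself, so that p can be removed even where f vanishes at p.\<close>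
  have "P (I +>\<^bsub>kQ\<^esub> f)" if "finite S" "{p. f p \<noteq> 0} \<subseteq> S" "S \<subseteq> paths Q" for f S
    using that
  proof (induction S arbitrary: f rule: finite_induct)
    case empty
    then have "f = \<zero>\<^bsub>kQ\<^esub>" by (auto simp: zero_kQ)
    then show ?case using zero quot.hom_zero by simp
  next
    case (insert p S)
    define g where "g = f(p := 0)"
    have p: "p \<in> paths Q" and S: "{q. g q \<noteq> 0} \<subseteq> S" "S \<subseteq> paths Q"
      using insert by (auto simp: g_def)
    have g: "g \<in> carrier kQ"
      using S insert(1) finite_subset by (auto simp: carrier_kQ)
    have h: "single_path p \<otimes>\<^bsub>kQ\<^esub> const (f p) \<in> carrier kQ"
      by (intro I.m_closed single_closed p const_closed)
    have "single_path p \<otimes>\<^bsub>kQ\<^esub> const (f p) = (\<lambda>q. f p * single_path p q)"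
      by (rule mult_const[OF single_closed[OF p]])
    then have f: "f = single_path p \<otimes>\<^bsub>kQ\<^esub> const (f p) \<oplus>\<^bsub>kQ\<^esub> g"
      by (simp add: add_kQ) (auto simp: g_def single_path_def)
    have "I +>\<^bsub>kQ\<^esub> (single_path p \<otimes>\<^bsub>kQ\<^esub> const (f p)) = path_elem Q I p \<otimes>\<^bsub>A\<^esub> scalar (f p)"
      using quot.hom_mult[OF single_closed[OF p] const_closed, of "f p"]
      by (simp add: path_elem_def scalar_const)
    moreover have "I +>\<^bsub>kQ\<^esub> f = (I +>\<^bsub>kQ\<^esub> (single_path p \<otimes>\<^bsub>kQ\<^esub> const (f p))) \<oplus>\<^bsub>A\<^esub> (I +>\<^bsub>kQ\<^esub> g)"
      using quot.hom_add[OF h g] f by simp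
    ultimately show ?case
      using add path[OF p] insert.IH[OF S] p g by simp
  qed
  moreover obtain f where "f \<in> carrier kQ" "a = I +>\<^bsub>kQ\<^esub> f"
    using a by (rule A_cases)
  ultimately show ?thesis by (auto simp: carrier_kQ)
qed

section \<open>Cardinality of the quotient algebra and of its modules\<close>

lemma countable_paths: "countable (paths Q)"
proof -
  have "paths Q \<subseteq> verts Q \<times> lists (arcs Q)"
    by (auto simp: paths_def awalk_def)
  moreover have "countable (verts Q \<times> lists (arcs Q))"
    by (intro countable_SIGMA countable_lists countable_finite finite_verts finite_arcs)
  ultimately show ?thesis by (rule countable_subset)
qed

text \<open>A function of finite support is encoded by its graph over the support, a finite set of
  pairs of a path and a scalar. There are only countably many paths, so these pairs embed into
  \<open>X\<close>, and an infinite set has as many finite subsets as elements.\<close>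

lemma lepoll_A:
  assumes inf: "infinite X" and k: "(UNIV :: 'k set) \<lesssim> X"
  shows "carrier A \<lesssim> X"
proof -
  have "paths Q \<lesssim> (UNIV :: nat set)"
    unfolding lepoll_def using inj_on_to_nat_on[OF countable_paths] by blast
  then have "paths Q \<lesssim> X"
    using inf lepoll_trans by (auto simp: infinite_le_lepoll)
  then have "paths Q \<times> (UNIV :: 'k set) \<lesssim> X \<times> X"
    using k by (rule times_lepoll_mono)
  also have "\<dots> \<approx> X"
    using card_of_Times_same_infinite[OF inf] by (simp add: eqpoll_iff_card_of_ordIso)
  finally obtain g where g: "inj_on g (paths Q \<times> (UNIV :: 'k set))" "g ` (paths Q \<times> UNIV) \<subseteq> X"
    by (auto simp: lepoll_def)
  define graph where "graph f = {(p, f p) | p. f p \<noteq> 0}" for f :: "'v \<times> 'e list \<Rightarrow> 'k"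
  have graph_sub: "graph f \<in> Fpow (paths Q \<times> UNIV)" if "f \<in> carrier kQ" for f
  proof -
    have "graph f = (\<lambda>p. (p, f p)) ` {p. f p \<noteq> 0}" by (auto simp: graph_def)
    then show ?thesis using that by (auto simp: Fpow_def carrier_kQ)
  qed
  have "inj graph"
  proof (rule injI, rule ext)
    fix f f' :: "'v \<times> 'e list \<Rightarrow> 'k" and p
    assume eq: "graph f = graph f'"
    have "(p, c) \<in> graph h \<longleftrightarrow> h p = c \<and> c \<noteq> 0" for h c
      by (cases p) (auto simp: graph_def)
    then show "f p = f' p" using eq by metis
  qed
  have "carrier A \<subseteq> (+>\<^bsub>kQ\<^esub>) I ` carrier kQ"
    by (auto elim: A_cases)
  then have "carrier A \<lesssim> carrier kQ" by (rule subset_image_lepoll)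
  also have "carrier kQ \<lesssim> Fpow (paths Q \<times> (UNIV :: 'k set))"
    unfolding lepoll_def using graph_sub \<open>inj graph\<close> by (blast intro: inj_on_subset)
  also have "\<dots> \<lesssim> Fpow X"
    unfolding lepoll_def
    using g by (intro exI[of _ "image g"] conjI inj_on_image_Fpow image_Fpow_mono)
  also have "\<dots> \<approx> X" by (rule eqpoll_Fpow[OF inf])
  finally show ?thesis .
qed

text \<open>For x \<noteq> 0 the map c \<mapsto> c x is injective, because a nonzero difference of
  scalars has an invertible image in \<open>A\<close>.\<close>

lemma lepoll_module:
  assumes M: "left_module A M" and x: "x \<in> carrier M" "x \<noteq> \<zero>\<^bsub>M\<^esub>"
  shows "(UNIV :: 'k set) \<lesssim> carrier M"
proof -
  interpret M: left_module A M by fact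
  have "inj (\<lambda>c. scalar c \<odot>\<^bsub>M\<^esub> x)"
  proof (rule injI)
    fix c d assume eq: "scalar c \<odot>\<^bsub>M\<^esub> x = scalar d \<odot>\<^bsub>M\<^esub> x"
    have "scalar (c - d) \<odot>\<^bsub>M\<^esub> x = \<zero>\<^bsub>M\<^esub>"
      using x(1) eq by (simp add: scalar_diff[symmetric] A.minus_eq M.smult_l_distr M.a_inv_smult
          M.smult_closed M.M.r_neg)
    then have "c - d \<noteq> 0 \<Longrightarrow> x = \<zero>\<^bsub>M\<^esub>"
      using M.smult_assoc[of "scalar (inverse (c - d))" "scalar (c - d)" x] x(1)
      by (simp add: scalar_inverse M.smult_one)
    then show "c = d" using x(2) by auto
  qed
  then show ?thesis
    unfolding lepoll_def using x(1) by (intro exI[of _ "\<lambda>c. scalar c \<odot>\<^bsub>M\<^esub> x"]) (auto intro: M.smult_closed)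
qed

end

section \<open>Extensions whose vertices are arranged in levels\<close>

lemma (in quiver_quotient) vertex_sum_commute:
  assumes "S \<subseteq> verts Q" "v \<in> verts Q"
  shows "(\<Oplus>\<^bsub>A\<^esub>e\<in>S. vertex e) \<otimes>\<^bsub>A\<^esub> vertex v = vertex v \<otimes>\<^bsub>A\<^esub> (\<Oplus>\<^bsub>A\<^esub>e\<in>S. vertex e)"
proof -
  have S: "finite S" "vertex \<in> S \<rightarrow> carrier A"
    using assms(1) finite_subset[OF _ finite_verts] by auto
  have "(\<Oplus>\<^bsub>A\<^esub>e\<in>S. vertex e \<otimes>\<^bsub>A\<^esub> vertex v) = (\<Oplus>\<^bsub>A\<^esub>e\<in>S. vertex v \<otimes>\<^bsub>A\<^esub> vertex e)"
    using assms by (intro A.finsum_cong' refl) (auto simp: vertex_mult subset_iff)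
  then show ?thesis
    using S assms(2) by (simp add: A.finsum_ldistr A.finsum_rdistr)
qed

text \<open>The level of a vertex is the index of its block, which turns both conditions on arrows
  into statements about levels. Of the quiver generating \<open>B\<close> only its set
  \<open>S\<close> of vertices and arrows is kept; the alternatives in \<open>S_cases\<close> are
  those of the vertices and of the arrows.\<close>

locale layered_extension = quiver_quotient Q I
  for Q :: "('v, 'e) pre_digraph" and I :: "('v \<times> 'e list \<Rightarrow> 'k::field) set" +
  fixes B S :: "('v \<times> 'e list \<Rightarrow> 'k) set set" and level :: "'v \<Rightarrow> nat"
  assumes infinite_field: "infinite (UNIV :: 'k set)"
    and level_pos: "v \<in> verts Q \<Longrightarrow> 0 < level v"
    and level_arc: "a \<in> arcs Q \<Longrightarrow> level (head Q a) \<le> level (tail Q a)"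
    and level_eq_loop: "a \<in> arcs Q \<Longrightarrow> level (head Q a) = level (tail Q a) \<Longrightarrow> head Q a = tail Q a"
    and B_generated: "B = generated_subalgebra (range (scalar_elem Q I)) (quiver_algebra Q I) S"
    and S_closed: "S \<subseteq> carrier (quiver_algebra Q I)"
    and S_cases: "s \<in> S \<Longrightarrow>
      (\<forall>v\<in>verts Q. s \<otimes>\<^bsub>quiver_algebra Q I\<^esub> vertex_elem Q I v = vertex_elem Q I v \<otimes>\<^bsub>quiver_algebra Q I\<^esub> s) \<or>
      (\<forall>v\<in>verts Q.
        (\<exists>h\<in>verts Q. s \<otimes>\<^bsub>quiver_algebra Q I\<^esub> vertex_elem Q I v =
          vertex_elem Q I h \<otimes>\<^bsub>quiver_algebra Q I\<^esub> s \<otimes>\<^bsub>quiver_algebra Q I\<^esub> vertex_elem Q I v) \<and>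
        (\<exists>g\<in>verts Q. vertex_elem Q I v \<otimes>\<^bsub>quiver_algebra Q I\<^esub> s =
          vertex_elem Q I v \<otimes>\<^bsub>quiver_algebra Q I\<^esub> s \<otimes>\<^bsub>quiver_algebra Q I\<^esub> vertex_elem Q I g))"
    and loop_factor: "\<lbrakk>a \<in> arcs Q; head Q a = tail Q a\<rbrakk> \<Longrightarrow>
      \<exists>b\<in>B. arrow_elem Q I a = vertex_elem Q I (tail Q a) \<otimes>\<^bsub>quiver_algebra Q I\<^esub> b"
begin

lemma range_scalar: "range scalar \<subseteq> carrier A"
  by auto

lemmas B_facts = A.generated_subalgebra[OF range_scalar S_closed, folded B_generated]

end

text \<open>The bound j measures the progress of the resolution. When j is at least the largest
  level the condition is vacuous, so every module qualifies at the start.\<close>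

locale layered_module = layered_extension Q I B S level + M: left_module "quiver_algebra Q I" M
  for Q :: "('v, 'e) pre_digraph" and I :: "('v \<times> 'e list \<Rightarrow> 'k::field) set"
    and B S level and M :: "(('v \<times> 'e list \<Rightarrow> 'k) set, 'm) module" +
  fixes j :: nat
  assumes killed: "\<lbrakk>v \<in> verts Q; j < level v; x \<in> carrier M\<rbrakk> \<Longrightarrow> vertex_elem Q I v \<odot>\<^bsub>M\<^esub> x = \<zero>\<^bsub>M\<^esub>"
begin

sublocale idempotent_tensor "quiver_algebra Q I" B M "verts Q" "vertex_elem Q I"
proof (intro idempotent_tensor.intro idempotent_tensor_axioms.intro A.ring_axioms M.left_module_axioms)
  show "subring B A" by (rule B_facts(1))
  show "vertex v \<otimes>\<^bsub>A\<^esub> vertex w = (if v = w then vertex v else \<zero>\<^bsub>A\<^esub>)"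
    if "v \<in> verts Q" "w \<in> verts Q" for v w
    using that by (rule vertex_mult)
qed (simp_all add: vertex_sum)

lemma scalar_linear: "scalar c \<in> linear_scalars"
  using B_facts(2) by (intro central_linear scalar_mult_commute) auto

text \<open>Generators suffice, as \<open>linear_scalars\<close> is a subring. Each generator also
  has to lie in \<open>B\<close>, because it is moved across a tensor over \<open>B\<close>.\<close>

lemma B_subset_linear: "B \<subseteq> linear_scalars"
proof -
  have "s \<in> linear_scalars" if s: "s \<in> S" for s
  proof -
    have "s \<in> B" using B_facts(3) s by blast
    with S_cases[OF s] show ?thesis
      using central_linear[of s] monomial_linear[of s] by blast
  qed
  then have "generated_subalgebra (range (scalar_elem Q I)) (quiver_algebra Q I) S \<subseteq> linear_scalars"
    using scalar_linear by (intro generated_subalgebra_least subring_linear_scalars) auto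
  then show ?thesis by (simp only: B_generated[symmetric])
qed

sublocale split_tensor "quiver_algebra Q I" B M "verts Q" "vertex_elem Q I"
  by (intro split_tensor.intro split_tensor_axioms.intro idempotent_tensor_axioms B_subset_linear)

text \<open>Induction on the last arrow of the path, from w to v. Levels do not rise along arrows,
  so w has level at least j as well. Above j both sides are zero, because the shorter path sends m
  into w M = 0. At level j the arrow is a loop at v, hence of the form v b with b in
  \<open>B\<close>, and both v and b commute with \<sigma>. The factor v on the right-hand side is
  what the next arrow absorbs.\<close>

lemma path_sigma:
  assumes "awalk u p v" "j \<le> level v" and m: "m \<in> carrier M"
  shows "path u p \<odot>\<^bsub>T\<^esub> section_map m = vertex v \<odot>\<^bsub>T\<^esub> section_map (path u p \<odot>\<^bsub>M\<^esub> m)"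
  using assms(1,2)
proof (induction p arbitrary: v rule: rev_induct)
  case Nil
  then have "v = u" "u \<in> verts Q" by (auto simp: awalk_Nil_iff)
  then show ?case
    using m linear_scalarsD(2)[OF e_linear, of u m] by (simp add: T.smult_assoc[symmetric] vertex_mult)
next
  case (snoc a p)
  define w where "w = tail Q a"
  define m' where "m' = path u p \<odot>\<^bsub>M\<^esub> m"
  have walk: "awalk u p w" and a: "a \<in> arcs Q" "head Q a = v"
    using snoc.prems(1) by (auto simp: w_def awalk_simps awlast_append)
  have w: "w \<in> verts Q" and v: "v \<in> verts Q" and last: "awlast u p = w"
    using walk a awalk_last_in_verts awalk_ends by auto
  have paths: "(u, p) \<in> paths Q" "(w, [a]) \<in> paths Q" "(w, []) \<in> paths Q" "(v, []) \<in> paths Q"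
    using walk last a(1) arrow_path w v by (auto simp: paths_iff w_def awalk_Nil_iff)
  have arrow [simp]: "arrow a \<in> carrier A" and path [simp]: "path u p \<in> carrier A"
    using paths by (simp_all add: w_def)
  have m': "m' \<in> carrier M" using m by (simp add: m'_def)
  have snoc_eq: "path u (p @ [a]) = arrow a \<otimes>\<^bsub>A\<^esub> path u p"
    using path_mult[OF paths(2,1)] last by (simp add: w_def)
  have arrow_w: "arrow a \<otimes>\<^bsub>A\<^esub> vertex w = arrow a"
    using path_mult[OF paths(2,3)] by (simp add: w_def)
  have v_arrow: "vertex v \<otimes>\<^bsub>A\<^esub> arrow a = arrow a"
    using path_mult[OF paths(4,2)] a(2) by (simp add: w_def)
  have w_m': "vertex w \<odot>\<^bsub>M\<^esub> m' = m'"
    using path_mult[OF paths(3,1)] last m w by (simp add: m'_def M.smult_assoc[symmetric])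
  have "level v \<le> level w" using level_arc[OF a(1)] a(2) by (simp add: w_def)
  then have IH: "path u p \<odot>\<^bsub>T\<^esub> section_map m = vertex w \<odot>\<^bsub>T\<^esub> section_map m'"
    using snoc.IH[OF walk] snoc.prems(2) by (simp add: m'_def)
  have "path u (p @ [a]) \<odot>\<^bsub>T\<^esub> section_map m = (arrow a \<otimes>\<^bsub>A\<^esub> vertex w) \<odot>\<^bsub>T\<^esub> section_map m'"
    unfolding snoc_eq using m m' w IH by (simp add: T.smult_assoc)
  then have lhs: "path u (p @ [a]) \<odot>\<^bsub>T\<^esub> section_map m = arrow a \<odot>\<^bsub>T\<^esub> section_map m'"
    by (simp add: arrow_w)
  have rhs: "path u (p @ [a]) \<odot>\<^bsub>M\<^esub> m = arrow a \<odot>\<^bsub>M\<^esub> m'"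
    unfolding snoc_eq m'_def using m by (simp add: M.smult_assoc)
  show ?case
  proof (cases "j < level w")
    case True
    then have "m' = \<zero>\<^bsub>M\<^esub>" using killed[OF w _ m'] w_m' by simp
    then show ?thesis unfolding lhs rhs using v by simp
  next
    case False
    \<comment> \<open>Here j \<le> level v \<le> level w \<le> j, so the arrow stays inside one
      block and must be a loop.\<close>
    then have "level v = level w"
      using snoc.prems(2) \<open>level v \<le> level w\<close> by simp
    then have loop: "head Q a = tail Q a" "w = v"
      using level_eq_loop[OF a(1)] a(2) by (simp_all add: w_def)
    obtain b where b: "b \<in> B" "arrow a = vertex v \<otimes>\<^bsub>A\<^esub> b"
      using loop_factor[OF a(1) loop(1)] loop(2) by (auto simp: w_def)
    have bA: "b \<in> carrier A" using b(1) by (rule B_closed)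
    have lin: "b \<odot>\<^bsub>T\<^esub> section_map m' = section_map (b \<odot>\<^bsub>M\<^esub> m')"
      using linear_scalarsD(2) B_subset_linear b(1) m' by auto
    have vlin: "vertex v \<odot>\<^bsub>T\<^esub> section_map y = section_map (vertex v \<odot>\<^bsub>M\<^esub> y)" if "y \<in> carrier M" for y
      using linear_scalarsD(2)[OF e_linear[OF v] that] by simp
    have "arrow a \<odot>\<^bsub>T\<^esub> section_map m' = vertex v \<odot>\<^bsub>T\<^esub> (b \<odot>\<^bsub>T\<^esub> section_map m')"
      unfolding b(2) using v bA m' by (simp add: T.smult_assoc)
    also have "\<dots> = section_map (vertex v \<odot>\<^bsub>M\<^esub> (b \<odot>\<^bsub>M\<^esub> m'))"
      unfolding lin using bA m' by (simp add: vlin)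
    also have "vertex v \<odot>\<^bsub>M\<^esub> (b \<odot>\<^bsub>M\<^esub> m') = arrow a \<odot>\<^bsub>M\<^esub> m'"
      unfolding b(2) using v bA m' by (simp add: M.smult_assoc)
    also have "\<dots> = vertex v \<odot>\<^bsub>M\<^esub> (arrow a \<odot>\<^bsub>M\<^esub> m')"
      using v m' v_arrow by (simp add: M.smult_assoc[symmetric])
    finally show ?thesis
      unfolding lhs rhs using m' by (simp add: vlin)
  qed
qed

text \<open>Multiplication by f keeps the paths ending at f, where \<open>path_sigma\<close>
  applies, and makes both sides vanish for all others. This provides the hypothesis \<open>L\<close>
  of \<open>smult_pi\<close> and \<open>rel_projective_self\<close> for the vertices of level at
  least j.\<close>

lemma top_linear:
  assumes f: "f \<in> verts Q" "j \<le> level f" and b: "b \<in> carrier A" and m: "m \<in> carrier M"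
  shows "vertex f \<odot>\<^bsub>T\<^esub> (b \<odot>\<^bsub>T\<^esub> section_map m) = vertex f \<odot>\<^bsub>T\<^esub> section_map (b \<odot>\<^bsub>M\<^esub> m)"
  using b
proof (induction rule: A_induct)
  case zero
  then show ?case using f m by simp
next
  case (add a b)
  then show ?case
    using f m by (simp add: T.smult_l_distr M.smult_l_distr T.smult_r_distr sigma_add)
next
  case (path c p)
  obtain u q where p: "p = (u, q)" by (cases p)
  define v where "v = awlast u q"
  have walk: "awalk u q v" using path p by (simp add: v_def paths_iff)
  have v: "v \<in> verts Q" using walk awalk_last_in_verts by blast
  have closed: "path u q \<in> carrier A" using path p by simp
  \<comment> \<open>The scalar c commutes with \<sigma>, so it can be moved into m on both sides,
    which leaves a bare path.\<close>
  define m' where "m' = scalar c \<odot>\<^bsub>M\<^esub> m"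
  have m': "m' \<in> carrier M" using m by (simp add: m'_def)
  have scalar: "(path u q \<otimes>\<^bsub>A\<^esub> scalar c) \<odot>\<^bsub>T\<^esub> section_map m = path u q \<odot>\<^bsub>T\<^esub> section_map m'"
    "(path u q \<otimes>\<^bsub>A\<^esub> scalar c) \<odot>\<^bsub>M\<^esub> m = path u q \<odot>\<^bsub>M\<^esub> m'"
    using closed m linear_scalarsD(2)[OF scalar_linear m, of c]
    by (simp_all add: T.smult_assoc M.smult_assoc m'_def)
  have f_path: "vertex f \<otimes>\<^bsub>A\<^esub> path u q = (if f = v then path u q else \<zero>\<^bsub>A\<^esub>)"
    using path_mult[of f "[]" u q] path p f by (auto simp: vertex_path v_def)
  have "vertex f \<odot>\<^bsub>T\<^esub> (path u q \<odot>\<^bsub>T\<^esub> section_map m') = vertex f \<odot>\<^bsub>T\<^esub> section_map (path u q \<odot>\<^bsub>M\<^esub> m')"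
  proof (cases "f = v")
    case True
    then show ?thesis
      using path_sigma[OF walk _ m'] f closed m' by (simp add: T.smult_assoc[symmetric] vertex_mult)
  next
    case False
    have "vertex f \<odot>\<^bsub>T\<^esub> (path u q \<odot>\<^bsub>T\<^esub> section_map m') = \<zero>\<^bsub>T\<^esub>"
      using f closed m' f_path False by (simp add: T.smult_assoc[symmetric])
    moreover have "vertex f \<odot>\<^bsub>T\<^esub> section_map (path u q \<odot>\<^bsub>M\<^esub> m') = section_map (vertex f \<odot>\<^bsub>M\<^esub> (path u q \<odot>\<^bsub>M\<^esub> m'))"
      using f closed m' linear_scalarsD(2)[OF e_linear] by simp
    moreover have "vertex f \<odot>\<^bsub>M\<^esub> (path u q \<odot>\<^bsub>M\<^esub> m') = \<zero>\<^bsub>M\<^esub>"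
      using f closed m' f_path False by (simp add: M.smult_assoc[symmetric])
    ultimately show ?thesis by simp
  qed
  then show ?case unfolding p scalar .
qed

lemma tensor_product_embeds: "\<exists>\<phi> :: ((('v \<times> 'e list \<Rightarrow> 'k) set \<times> 'm) \<Rightarrow>\<^sub>0 int) set \<Rightarrow> 'm. inj_on \<phi> (carrier T)"
proof (cases "carrier M = {\<zero>\<^bsub>M\<^esub>}")
  \<comment> \<open>The zero module is finite and escapes the cardinality argument. Its tensor
    product has a single element, so any function is injective on it.\<close>
  case True
  have T_zero: "x = \<zero>\<^bsub>T\<^esub>" if "x \<in> carrier T" for x
    using that by (induction rule: tensor_induct) (simp_all add: True)
  have "inj_on (\<lambda>_. undefined :: 'm) (carrier T)"
  proof (rule inj_onI)
    fix x y assume "x \<in> carrier T" "y \<in> carrier T"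
    then show "x = y" using T_zero[of x] T_zero[of y] by simp
  qed
  then show ?thesis by blast
next
  case False
  then obtain x where x: "x \<in> carrier M" "x \<noteq> \<zero>\<^bsub>M\<^esub>" using M.M.zero_closed by blast
  have k: "(UNIV :: 'k set) \<lesssim> carrier M" by (rule lepoll_module[OF M.left_module_axioms x])
  then have inf: "infinite (carrier M)"
    using infinite_field by (metis finite_lepoll_infinite infinite_le_lepoll lepoll_trans)
  have "carrier T \<lesssim> carrier M"
    by (rule lepoll_tensor_product_universe[OF lepoll_A[OF inf k] inf])
  then show ?thesis by (auto simp: lepoll_def)
qed

end

context layered_extension
begin

text \<open>Length j goes with the bound j + 1 on the levels of vertices that may act nontrivially.
  A cover lowers the bound of its kernel by one, so \<open>M\<close> has to be arbitrary in the
  induction.\<close>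

lemma layered_resolution:
  fixes M :: "(('v \<times> 'e list \<Rightarrow> 'k) set, 'm) module"
  assumes "left_module A M"
    and "\<And>v x. \<lbrakk>v \<in> verts Q; Suc j < level v; x \<in> carrier M\<rbrakk> \<Longrightarrow> vertex v \<odot>\<^bsub>M\<^esub> x = \<zero>\<^bsub>M\<^esub>"
  shows "has_rel_resolution A B M j"
  using assms
proof (induction j arbitrary: M)
  case 0
  interpret layered_module Q I B S level M "Suc 0"
    by (intro layered_module.intro layered_module_axioms.intro layered_extension_axioms 0)
  \<comment> \<open>With bound 1 every vertex has level at least the bound, so
    \<open>top_linear\<close> makes \<sigma> linear over all of \<open>A\<close>.\<close>
  have "rel_projective A B M"
    by (intro rel_projective_self top_linear) (simp_all add: Suc_le_eq level_pos)
  then show ?case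
    by (intro has_rel_resolution_zero A.ring_axioms B_facts(1))
next
  case (Suc j)
  interpret layered_module Q I B S level M "Suc (Suc j)"
    by (intro layered_module.intro layered_module_axioms.intro layered_extension_axioms Suc.prems)
  obtain \<phi> :: "((('v \<times> 'e list \<Rightarrow> 'k) set \<times> 'm) \<Rightarrow>\<^sub>0 int) set \<Rightarrow> 'm" where "inj_on \<phi> (carrier T)"
    using tensor_product_embeds by blast
  then obtain P :: "(('v \<times> 'e list \<Rightarrow> 'k) set, 'm) module" and q
    where P: "rel_projective A B P" and q: "q \<in> left_module_hom A P M" "q ` carrier P = carrier M"
      and summand: "direct_summand (A\<lparr>carrier := B\<rparr>) P (a_kernel P M q)"
      and ker: "\<And>a x. \<lbrakk>a \<in> carrier A; x \<in> a_kernel P M q;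
        \<And>b m. b \<in> carrier A \<Longrightarrow> m \<in> carrier M \<Longrightarrow>
          a \<odot>\<^bsub>T\<^esub> (b \<odot>\<^bsub>T\<^esub> section_map m) = a \<odot>\<^bsub>T\<^esub> section_map (b \<odot>\<^bsub>M\<^esub> m)\<rbrakk>
      \<Longrightarrow> a \<odot>\<^bsub>P\<^esub> x = \<zero>\<^bsub>P\<^esub>"
    by (rule rel_projective_cover) blast
  have lP: "left_module A P" using P by (simp add: rel_projective_def)
  let ?K = "P\<lparr>carrier := a_kernel P M q\<rparr>"
  have "left_module A ?K"
    by (intro left_module.submodule_is_left_module[OF lP] submodule_a_kernel[OF q(1) lP] M.left_module_axioms)
  \<comment> \<open>\<open>M\<close> is assumed to be killed strictly above its bound
    \<open>Suc (Suc j)\<close>, whereas \<open>top_linear\<close> applies from the bound itself on.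
    This one extra level is what the induction hypothesis needs.\<close>
  moreover have "vertex v \<odot>\<^bsub>?K\<^esub> x = \<zero>\<^bsub>?K\<^esub>"
    if "v \<in> verts Q" "Suc j < level v" "x \<in> carrier ?K" for v x
    using that ker[of "vertex v" x] top_linear[of v] by simp
  ultimately have "has_rel_resolution A B ?K j" by (rule Suc.IH)
  then show ?case
    by (intro has_rel_resolution_Suc[OF M.left_module_axioms P q summand])
qed

text \<open>No vertex lies above level n, so every module meets the condition of
  \<open>layered_resolution\<close>. The assumption \<open>0 < n\<close> makes
  \<open>Suc (n - 1)\<close> equal to n despite truncated subtraction.\<close>

lemma rel_gldim_le:
  assumes "\<And>v. v \<in> verts Q \<Longrightarrow> level v \<le> n" "0 < n"
  shows "rel_gldim TYPE('m) A B \<le> enat (n - 1)"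
proof (rule rel_gldim_leI)
  fix M :: "(('v \<times> 'e list \<Rightarrow> 'k) set, 'm) module"
  assume "left_module A M"
  then show "has_rel_resolution A B M (n - 1)"
    by (rule layered_resolution) (use assms in \<open>force simp: not_less[symmetric]\<close>)
qed

end

theorem theorem3p2:
  fixes Q :: "('v, 'e) pre_digraph"
    and V :: "nat \<Rightarrow> 'v set"
    and n :: nat
    and I :: "('v \<times> 'e list \<Rightarrow> 'k::alg_closed_field) set"
    and A :: "('v \<times> 'e list \<Rightarrow> 'k) set ring"
    and R :: "(('v \<times> 'e list \<Rightarrow> 'k) set, ('v \<times> 'e list \<Rightarrow> 'k) set) pre_digraph"
    and B :: "('v \<times> 'e list \<Rightarrow> 'k) set set"
  assumes Q: "fin_digraph Q"
    and n: "1 \<le> n"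
    and V_nonempty: "\<forall>i\<in>{1..n}. V i \<noteq> {}"
    and V_disjoint: "disjoint_family_on V {1..n}"
    and V_Union: "(\<Union>i\<in>{1..n}. V i) = verts Q"
    and arrows_between: "\<forall>a\<in>arcs Q. \<forall>i\<in>{1..n}. \<forall>j\<in>{1..n}.
          i < j \<longrightarrow> \<not> (tail Q a \<in> V i \<and> head Q a \<in> V j)"
    and arrows_within: "\<forall>a\<in>arcs Q. \<forall>i\<in>{1..n}.
          tail Q a \<in> V i \<and> head Q a \<in> V i \<longrightarrow> tail Q a = head Q a"
    and I: "admissible_ideal Q I"
    and A: "A = quiver_algebra Q I"
    and R: "wf_digraph R" "verts R \<subseteq> carrier A" "arcs R \<subseteq> carrier A"
    and R_arrows: "\<forall>\<beta>\<in>arcs R. \<beta> = head R \<beta> \<otimes>\<^bsub>A\<^esub> \<beta> \<otimes>\<^bsub>A\<^esub> tail R \<beta>"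
    and B: "B = generated_subalgebra (range (scalar_elem Q I)) A (verts R \<union> arcs R)"
    and i: "\<forall>x\<in>verts R. \<exists>S\<subseteq>verts Q. x = (\<Oplus>\<^bsub>A\<^esub>e\<in>S. vertex_elem Q I e)"
    and ii_paths: "\<forall>\<beta>\<in>arcs R. \<exists>S c. finite S \<and> S \<subseteq> paths Q \<and>
          \<beta> = (\<Oplus>\<^bsub>A\<^esub>p\<in>S. scalar_elem Q I (c p) \<otimes>\<^bsub>A\<^esub> path_elem Q I p)"
    and ii_vertices: "\<forall>\<beta>\<in>arcs R. \<forall>e\<in>verts Q. \<exists>h\<in>verts Q. \<exists>g\<in>verts Q.
          \<beta> \<otimes>\<^bsub>A\<^esub> vertex_elem Q I e = vertex_elem Q I h \<otimes>\<^bsub>A\<^esub> \<beta> \<otimes>\<^bsub>A\<^esub> vertex_elem Q I e \<and>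
          vertex_elem Q I e \<otimes>\<^bsub>A\<^esub> \<beta> = vertex_elem Q I e \<otimes>\<^bsub>A\<^esub> \<beta> \<otimes>\<^bsub>A\<^esub> vertex_elem Q I g"
    and iii: "\<forall>e\<in>verts Q. \<forall>\<gamma>\<in>arcs Q. tail Q \<gamma> = e \<and> head Q \<gamma> = e \<longrightarrow>
          (\<exists>\<beta>\<in>B. arrow_elem Q I \<gamma> = vertex_elem Q I e \<otimes>\<^bsub>A\<^esub> \<beta>)"
  shows "rel_gldim TYPE('m) A B \<le> enat (n - 1)"
proof -
  interpret ideal I "path_algebra Q" using I by (simp add: admissible_ideal_def)
  interpret quiver_quotient Q I
    by (intro quiver_quotient.intro Q ideal_axioms)
  have "\<forall>v\<in>verts Q. \<exists>i\<in>{1..n}. v \<in> V i" using V_Union by blast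
  then obtain level where level: "\<And>v. v \<in> verts Q \<Longrightarrow> level v \<in> {1..n} \<and> v \<in> V (level v)"
    by metis
  have ends: "tail Q a \<in> verts Q" "head Q a \<in> verts Q" if "a \<in> arcs Q" for a
    using that by auto
  interpret layered_extension Q I B "verts R \<union> arcs R" level
  proof (unfold_locales, goal_cases)
    case 1
    show ?case by (rule infinite_UNIV_alg_closed_field)
  next
    case (2 v)
    then show ?case using level by fastforce
  next
    case (3 a)
    then show ?case using arrows_between level ends by (meson not_le)
  next
    case (4 a)
    then show ?case using arrows_within level ends by metis
  next
    case 5
    show ?case using B A by simp
  next
    case 6
    show ?case using R A by simp
  next
    case (7 s)
    show ?case
    \<comment> \<open>A vertex of \<open>R\<close> is a sum of vertices of \<open>Q\<close> and so
      commutes with every vertex, while an arrow of \<open>R\<close> satisfies the other alternative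
      by \<open>ii_vertices\<close>.\<close>
    proof (cases "s \<in> verts R")
      case True
      then obtain S where S: "S \<subseteq> verts Q" "s = (\<Oplus>\<^bsub>quiver_algebra Q I\<^esub>e\<in>S. vertex e)"
        using i A by blast
      have "s \<otimes>\<^bsub>quiver_algebra Q I\<^esub> vertex v = vertex v \<otimes>\<^bsub>quiver_algebra Q I\<^esub> s"
        if "v \<in> verts Q" for v
        using S that by (intro vertex_sum_commute[of S v, folded S(2)])
      then show ?thesis by blast
    next
      case False
      then show ?thesis using 7 ii_vertices A by blast
    qed
  next
    case (8 a)
    then show ?case using iii ends A by metis
  qed
  show ?thesis
    unfolding A using level n by (intro rel_gldim_le) auto
qed

end
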